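(* Let $(G,\sigma)$ be an unbalanced signed unicyclic graph whose unique cycle is $C_q^{\sigma}$ (of length $q$). Then: (1) $\eta(G,\sigma)=|V(G)|-2m(G)-1$ if $q\equiv 1 \pmod 2$ and $m([T_G])=m(T_G)$; (2) $\eta(G,\sigma)=|V(G)|-2m(G)+2$ if $q\equiv 2 \pmod 4$ and $m([T_G])=m(T_G)$; (3) $\eta(G,\sigma)=|V(G)|-2m(G)$ in all other cases.
   Context: All graphs are finite and simple. A signed graph $(G,\sigma)$ is a graph $G$ together with a map $\sigma:E(G)\to\{+,-\}$; its adjacency matrix $A(G,\sigma)$ has $(i,j)$-entry $\sigma(v_iv_j)$ if $v_iv_j\in E(G)$ and $0$ otherwise. The nullity $\eta(G,\sigma)$ is the multiplicity of $0$ as an eigenvalue of $A(G,\sigma)$. The sign of a cycle is the product of the signs of its edges; $(G,\sigma)$ is balanced if every cycle is positive and unbalanced otherwise. A unicyclic graph is a connected graph containing exactly one cycle. $m(H)$ denotes the matching number (size of a maximum matching) of a graph $H$. For a graph $G$ whose cycles are pairwise vertex-disjoint, $T_G$ is the acyclic graph obtained from $G$ by contracting each cycle to a single vertex (called a cyclic vertex), and $[T_G]$ is the graph obtained from $T_G$ by deleting all cyclic vertices; for a unicyclic graph $G$ with cycle $C_q$, $[T_G]=G-V(C_q)$. *)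

theory Defs
  imports
    "Graph_Theory.Graph_Theory"
    "Jordan_Normal_Form.Char_Poly"
begin

text \<open>
  A finite simple graph is a \<^locale>\<open>pair_graph\<close>: a finite, loop-free, symmetric set of arcs.
  Each undirected edge is a pair of opposite arcs, represented below by its two-element set of
  end vertices.
\<close>

definition uedges :: "('a, 'b) pre_digraph \<Rightarrow> 'a set set" where
  "uedges G = (\<lambda>a. {tail G a, head G a}) ` arcs G"

definition matching :: "('a, 'b) pre_digraph \<Rightarrow> 'a set set \<Rightarrow> bool" where
  "matching G M \<longleftrightarrow> M \<subseteq> uedges G \<and> (\<forall>e\<in>M. \<forall>f\<in>M. e \<noteq> f \<longrightarrow> e \<inter> f = {})"

definition matching_number :: "('a, 'b) pre_digraph \<Rightarrow> nat" where
  "matching_number G = Max (card ` {M. matching G M})"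

text \<open>
  A cycle is a subgraph, identified with its edge set: its rotations and reversals are
  the same cycle. The library's \<^const>\<open>pre_digraph.cycle\<close> also holds of the closed walk that
  traverses one edge back and forth; the length bound excludes it. The cycle has vertex set
  \<open>\<Union>C\<close> and length \<open>card C\<close>.
\<close>

definition is_cycle :: "'a pair_pre_digraph \<Rightarrow> 'a set set \<Rightarrow> bool" where
  "is_cycle G C \<longleftrightarrow>
     (\<exists>p. pre_digraph.cycle (with_proj G) p \<and> 3 \<le> length p \<and> C = (\<lambda>(u, v). {u, v}) ` set p)"

definition unicyclic :: "'a pair_pre_digraph \<Rightarrow> bool" where
  "unicyclic G \<longleftrightarrow> Digraph_Component.connected (with_proj G) \<and> (\<exists>!C. is_cycle G C)"

definition signing :: "'a pair_pre_digraph \<Rightarrow> ('a set \<Rightarrow> real) \<Rightarrow> bool" where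
  "signing G \<sigma> \<longleftrightarrow> (\<forall>e\<in>uedges (with_proj G). \<sigma> e \<in> {1, -1})"

definition cycle_sign :: "('a set \<Rightarrow> real) \<Rightarrow> 'a set set \<Rightarrow> real" where
  "cycle_sign \<sigma> C = (\<Prod>e\<in>C. \<sigma> e)"

definition balanced :: "'a pair_pre_digraph \<Rightarrow> ('a set \<Rightarrow> real) \<Rightarrow> bool" where
  "balanced G \<sigma> \<longleftrightarrow> (\<forall>C. is_cycle G C \<longrightarrow> cycle_sign \<sigma> C = 1)"

text \<open>The list \<open>vs\<close> is an enumeration \<open>v\<^sub>1, \<dots>, v\<^sub>n\<close> of the vertex set.\<close>

definition adjacency_matrix ::
    "'a pair_pre_digraph \<Rightarrow> ('a set \<Rightarrow> real) \<Rightarrow> 'a list \<Rightarrow> real mat" where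
  "adjacency_matrix G \<sigma> vs = mat (length vs) (length vs)
     (\<lambda>(i, j). if (vs ! i, vs ! j) \<in> parcs G then \<sigma> {vs ! i, vs ! j} else 0)"

definition nullity :: "'a pair_pre_digraph \<Rightarrow> ('a set \<Rightarrow> real) \<Rightarrow> 'a list \<Rightarrow> nat" where
  "nullity G \<sigma> vs = Polynomial.order 0 (char_poly (adjacency_matrix G \<sigma> vs))"

text \<open>
  Contraction of every cycle to a single vertex, for graphs whose cycles are pairwise
  vertex-disjoint. A vertex of the contraction is the set of the vertices merged into it:
  \<open>\<Union>C\<close> for a cycle \<open>C\<close>, and \<open>{v}\<close> for a vertex \<open>v\<close> on no cycle.
\<close>

definition cyclic_vertices :: "'a pair_pre_digraph \<Rightarrow> 'a set set" where
  "cyclic_vertices G = {\<Union>C | C. is_cycle G C}"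

definition contract_cycles :: "'a pair_pre_digraph \<Rightarrow> 'a set pair_pre_digraph" where
  "contract_cycles G =
     (let W = cyclic_vertices G \<union> {{v} | v. v \<in> pverts G - \<Union>(cyclic_vertices G)}
      in \<lparr> pverts = W,
           parcs = {(A, B). A \<in> W \<and> B \<in> W \<and> A \<noteq> B \<and> (\<exists>u\<in>A. \<exists>v\<in>B. (u, v) \<in> parcs G)} \<rparr>)"

definition delete_cyclic_vertices :: "'a pair_pre_digraph \<Rightarrow> ('a set, 'a set \<times> 'a set) pre_digraph"
  where
  "delete_cyclic_vertices G =
     with_proj (contract_cycles G) \<restriction> (pverts (contract_cycles G) - cyclic_vertices G)"

end

theory Submission
  imports Defs "HOL-Combinatorics.Cycles"
begin

text \<open>
  The characteristic polynomial is expanded over permutations of the vertex set. A permutation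
  contributes only if every vertex it moves is sent along an edge. If it is an involution it is
  a matching; otherwise it rotates the unique cycle in one of the two directions and is a
  matching of \<open>G - V(C)\<close> elsewhere. For an unbalanced cycle this gives
  \<open>\<phi>(x) = \<Sum>\<^sub>M (-1)\<^bsup>|M|\<^esup> x\<^bsup>n - 2|M|\<^esup> + 2 \<Sum>\<^sub>N (-1)\<^bsup>|N|\<^esup> x\<^bsup>n - q - 2|N|\<^esup>\<close>,
  with \<open>M\<close> ranging over the matchings of \<open>G\<close> and \<open>N\<close> over those of \<open>G - V(C)\<close>, and the nullity
  is the least exponent whose coefficient survives.

  The condition \<open>m([T\<^sub>G]) = m(T\<^sub>G)\<close> says that every maximum matching of \<open>G - V(C)\<close> covers all
  vertices adjacent to \<open>C\<close>. As these lie in distinct components, a maximum matching of \<open>G\<close> then uses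
  no edge that leaves \<open>C\<close> when \<open>q\<close> is even: it is one of the two perfect matchings of \<open>C\<close> together
  with a maximum matching of \<open>G - V(C)\<close>, so for \<open>q \<equiv> 2 (mod 4)\<close> the two sums cancel at top order,
  and strict counting inequalities show that nothing else cancels.
\<close>

section \<open>Cycles as closed vertex paths\<close>

text \<open>The weight 2 does not depend on the parity of q: a q-cycle has sign (-1)^(q-1), the
  entries of xI - A contribute (-1)^q times the cycle sign -1, the product is 1, and the two
  directions double it. Parity decides whether the two sums can interfere. For odd q their exponents
  have opposite parities, so the only question is which sum reaches lower: 2 m(G) is compared with q
  + 2 m(G - V(C)), and the latter is larger, by exactly 1, under the condition of (1) and smaller
  otherwise. For q = 2h, k-matchings of G meet (k-h)-matchings of G - V(C) in the same exponent with
  relative sign (-1)^h, so cancellation needs h odd. The two directions then match the two perfect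
  matchings of C: twice the number of (k-h)-matchings of G - V(C) is the number of k-matchings of G
  that contain a perfect matching of C. Up to sign the coefficient counts all other k-matchings, and
  one example makes it nonzero. In (2) there is none at the top, while one edge below it h-1 cycle
  edges with a maximum matching of G - V(C) form one; hence the +2.\<close>

text \<open>Each vertex is listed once and the modulus supplies the closing arc. This is the form in
  which \<open>support\<close> lists the orbit of a permutation and \<open>cycle_of_list\<close>
  expects its argument.\<close>

definition closed_path :: "('a \<times> 'a) set \<Rightarrow> 'a list \<Rightarrow> bool" where
  "closed_path R xs \<longleftrightarrow> distinct xs \<and> 3 \<le> length xs \<and>
     (\<forall>i<length xs. (xs ! i, xs ! (Suc i mod length xs)) \<in> R)"

definition closed_path_edges :: "'a list \<Rightarrow> 'a set set" where
  "closed_path_edges xs = (\<lambda>i. {xs ! i, xs ! (Suc i mod length xs)}) ` {..<length xs}"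

text \<open>Replaces the recursion of \<open>pcas\<close> by a condition on indices, so that arc
  walks can be compared with vertex lists.\<close>

lemma pcas_conv_nth:
  "p \<noteq> [] \<Longrightarrow> pcas u p v \<longleftrightarrow> fst (hd p) = u \<and> snd (last p) = v \<and>
     (\<forall>i. Suc i < length p \<longrightarrow> snd (p ! i) = fst (p ! Suc i))"
proof (induction p arbitrary: u)
  case (Cons a p)
  show ?case
  proof (cases "p = []")
    case True
    then show ?thesis by (cases a) auto
  next
    case False
    then obtain b r where p: "p = b # r" by (cases p) auto
    have "(\<forall>i. Suc i < length (a # p) \<longrightarrow> snd ((a # p) ! i) = fst ((a # p) ! Suc i)) \<longleftrightarrow>
       snd a = fst (hd p) \<and> (\<forall>i. Suc i < length p \<longrightarrow> snd (p ! i) = fst (p ! Suc i))" (is "?l \<longleftrightarrow> ?r")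
    proof
      assume l: ?l
      show ?r
      proof
        show "snd a = fst (hd p)" using l[rule_format, of 0] p by auto
        show "\<forall>i. Suc i < length p \<longrightarrow> snd (p ! i) = fst (p ! Suc i)"
          using l[rule_format, of "Suc i" for i] by auto
      qed
    next
      assume r: ?r
      show ?l
      proof (intro allI impI)
        fix i assume "Suc i < length (a # p)"
        then show "snd ((a # p) ! i) = fst ((a # p) ! Suc i)"
          using r p by (cases i) auto
      qed
    qed
    then show ?thesis using Cons.IH[OF False] False by (cases a) auto
  qed
qed simp

text \<open>A step to a vertex already visited cuts the path back to that vertex instead of
  extending it.\<close>

lemma rtrancl_simple_path:
  assumes "(v, u) \<in> R\<^sup>*"
  obtains xs where "xs \<noteq> []" "distinct xs" "hd xs = v" "last xs = u"
    "successively (\<lambda>x y. (x, y) \<in> R) xs"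
proof -
  have "\<exists>xs. xs \<noteq> [] \<and> distinct xs \<and> hd xs = v \<and> last xs = u \<and> successively (\<lambda>x y. (x, y) \<in> R) xs"
    using assms
  proof (induction rule: rtrancl_induct)
    case base
    show ?case by (intro exI[of _ "[v]"]) auto
  next
    case (step y z)
    then obtain xs where xs: "xs \<noteq> []" "distinct xs" "hd xs = v" "last xs = y"
      "successively (\<lambda>x y. (x, y) \<in> R) xs" by blast
    show ?case
    proof (cases "z \<in> set xs")
      case True
      then obtain as bs where "xs = as @ z # bs" by (meson split_list)
      then have e: "xs = (as @ [z]) @ bs" by simp
      have "successively (\<lambda>x y. (x, y) \<in> R) (as @ [z])"
        using xs(5) unfolding e successively_append_iff[of _ "as @ [z]"] by blast
      moreover have "distinct (as @ [z])" using xs(2) unfolding e distinct_append by blast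
      moreover have "hd (as @ [z]) = v" using xs(3) e by (cases as) auto
      ultimately show ?thesis by (intro exI[of _ "as @ [z]"] conjI) simp_all
    next
      case False
      have "successively (\<lambda>x y. (x, y) \<in> R) (xs @ [z])"
        using xs step(2) unfolding successively_append_iff by simp
      then show ?thesis using xs(1-3) False
        by (intro exI[of _ "xs @ [z]"] conjI) simp_all
    qed
  qed
  then show ?thesis using that by blast
qed

text \<open>A simple path from \<open>v\<close> to \<open>u\<close> is closed by the arc
  \<open>(u, v)\<close>. It has at least three vertices because both orientations of the edge are
  removed before the path is chosen.\<close>

lemma edge_on_closed_path:
  assumes uv: "(u, v) \<in> R" "u \<noteq> v" 
    and r: "(v, u) \<in> (R - {(u, v), (v, u)})\<^sup>*"
  obtains xs where "closed_path R xs" "{u, v} \<in> closed_path_edges xs"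
proof -
  let ?S = "R - {(u, v), (v, u)}"
  obtain xs where xs: "xs \<noteq> []" "distinct xs" "hd xs = v" "last xs = u"
      and s: "successively (\<lambda>x y. (x, y) \<in> ?S) xs"
    using rtrancl_simple_path[OF r] .
  have s: "(xs ! i, xs ! Suc i) \<in> ?S" if "Suc i < length xs" for i
    using s that by (simp add: successively_conv_nth)
  have l1: "length xs \<noteq> Suc 0" using xs(3,4) uv(2) by (auto simp: length_Suc_conv)
  have "length xs \<noteq> 2"
  proof
    assume "length xs = 2"
    then show False using s[of 0] xs by (auto simp: hd_conv_nth last_conv_nth)
  qed
  then have l: "3 \<le> length xs" using l1 xs(1) by (cases "length xs") auto
  have last: "xs ! (length xs - 1) = u" "xs ! 0 = v" using xs by (auto simp: hd_conv_nth last_conv_nth)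
  have "closed_path R xs"
    unfolding closed_path_def
  proof (intro conjI allI impI)
    fix i assume i: "i < length xs"
    show "(xs ! i, xs ! (Suc i mod length xs)) \<in> R"
    proof (cases "Suc i = length xs")
      case True
      then show ?thesis using last uv(1) by (metis diff_Suc_1 mod_self)
    next
      case False
      then show ?thesis using s[of i] i by auto
    qed
  qed (use xs l in auto)
  moreover have "{u, v} \<in> closed_path_edges xs"
  proof -
    have "Suc (length xs - 1) mod length xs = 0" using l by (cases xs) auto
    then show ?thesis
      unfolding closed_path_edges_def using last l
      by (intro image_eqI[of _ _ "length xs - 1"]) auto
  qed
  ultimately show ?thesis by (rule that)
qed

context pair_wf_digraph
begin

text \<open>Zipping \<open>xs\<close> with its rotation pairs every vertex with its successor, the
  last one with the first, and so gives the arc list of the cycle.\<close>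

lemma closed_path_imp_is_cycle:
  assumes "closed_path (parcs G) xs"
  shows "is_cycle G (closed_path_edges xs)"
proof -
  define p where "p = zip xs (rotate1 xs)"
  have len: "length p = length xs" "3 \<le> length xs" and d: "distinct xs"
    using assms by (auto simp: p_def closed_path_def)
  have nth: "p ! i = (xs ! i, xs ! (Suc i mod length xs))" if "i < length xs" for i
    using that by (simp add: p_def nth_rotate1)
  have ne: "p \<noteq> []" "xs \<noteq> []" using len by auto
  have setp: "set p = (\<lambda>i. (xs ! i, xs ! (Suc i mod length xs))) ` {..<length xs}"
  proof -
    have "set p = (!) p ` {..<length xs}" using len by (auto simp: set_conv_nth)
    then show ?thesis using nth by (auto intro!: image_cong)
  qed
  have sub: "set p \<subseteq> parcs G"
    using assms by (auto simp: setp closed_path_def)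
  have last: "snd (last p) = hd xs"
    using nth[of "length xs - 1"] len ne by (simp add: last_conv_nth hd_conv_nth)
  have "pcas (hd xs) p (hd xs)"
    using nth len ne last by (auto simp: pcas_conv_nth hd_conv_nth)
  moreover have "hd xs \<in> pverts G"
    using sub ne len nth[of 0]
    by (metis arc_fst_in_verts fst_conv hd_conv_nth in_mono length_greater_0_conv nth_mem)
  ultimately have aw: "awalk (hd xs) p (hd xs)"
    using sub by (simp add: awalk_def)
  have mf: "map fst p = xs" by (simp add: p_def)
  have "pawalk_verts (hd xs) p = xs @ [hd xs]"
    using awalk_verts_conv[of "hd xs" p] ne mf last by simp
  then have "distinct (tl (pawalk_verts (hd xs) p))"
    using d ne by (cases xs) auto
  then have "cycle p" using aw ne by (auto simp: cycle_def)
  moreover have "closed_path_edges xs = (\<lambda>(u, v). {u, v}) ` set p"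
    unfolding setp closed_path_edges_def by (simp add: image_image)
  ultimately show ?thesis
    using len unfolding is_cycle_def by (intro exI[of _ p]) auto
qed

lemma is_cycleE:
  assumes "is_cycle G C"
  obtains xs where "closed_path (parcs G) xs" "C = closed_path_edges xs"
proof -
  obtain p where p: "cycle p" "3 \<le> length p" "C = (\<lambda>(u, v). {u, v}) ` set p"
    using assms by (auto simp: is_cycle_def)
  then obtain u where u: "awalk u p u" "distinct (tl (pawalk_verts u p))" "p \<noteq> []"
    by (auto simp: cycle_def)
  define xs where "xs = map fst p"
  have len: "length xs = length p" by (simp add: xs_def)
  have c: "fst (hd p) = u" "snd (last p) = u"
     "\<And>i. Suc i < length p \<Longrightarrow> snd (p ! i) = fst (p ! Suc i)"
    using u by (auto simp: awalk_def pcas_conv_nth)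
  have nth: "p ! i = (xs ! i, xs ! (Suc i mod length xs))" if "i < length xs" for i
  proof (cases "Suc i < length p")
    case True
    then show ?thesis using c(3)[of i] that by (simp add: xs_def prod_eq_iff)
  next
    case False
    then have i: "Suc i = length p" using that len by simp
    then have "p ! i = last p" using u(3) by (metis last_conv_nth diff_Suc_1)
    then show ?thesis using i c(1,2) that u(3)
      by (simp add: xs_def prod_eq_iff) (metis hd_conv_nth)
  qed
  have "pawalk_verts u p = xs @ [u]"
    using awalk_verts_conv[of u p] u(3) c(2) by (simp add: xs_def)
  moreover have "hd xs = u" using c u(3) by (simp add: xs_def hd_map)
  ultimately have "distinct xs" using u(2,3) len by (cases xs) auto
  then have "closed_path (parcs G) xs"
    using p(2) u(1) nth len unfolding closed_path_def awalk_def
    by (metis nth_mem subsetD)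
  moreover have "C = closed_path_edges xs"
  proof -
    have "set p = (!) p ` {..<length xs}" using len by (auto simp: set_conv_nth)
    then have "set p = (\<lambda>i. (xs ! i, xs ! (Suc i mod length xs))) ` {..<length xs}"
      using nth by (auto intro!: image_cong)
    then show ?thesis unfolding p(3) closed_path_edges_def by (simp add: image_image)
  qed
  ultimately show ?thesis using that by blast
qed

end

section \<open>Matchings and their involutions\<close>

text \<open>Taken over a bare edge set, so that parts of the graph and the contracted edges are
  handled without building a graph for each.\<close>

definition matchings :: "'a set set \<Rightarrow> 'a set set set" where
  "matchings E = {M. M \<subseteq> E \<and> (\<forall>e\<in>M. \<forall>f\<in>M. e \<noteq> f \<longrightarrow> e \<inter> f = {})}"

lemma matchings_mono: "E \<subseteq> F \<Longrightarrow> matchings E \<subseteq> matchings F"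
  by (auto simp: matchings_def)

lemma matchings_disjoint: "M \<in> matchings E \<Longrightarrow> e \<in> M \<Longrightarrow> f \<in> M \<Longrightarrow> e \<noteq> f \<Longrightarrow> e \<inter> f = {}"
  by (simp add: matchings_def)

lemma matchings_sub: "M \<in> matchings E \<Longrightarrow> M \<subseteq> E"
  by (simp add: matchings_def)

lemma matchingsI:
  "M \<subseteq> E \<Longrightarrow> (\<And>e f. e \<in> M \<Longrightarrow> f \<in> M \<Longrightarrow> e \<noteq> f \<Longrightarrow> e \<inter> f = {}) \<Longrightarrow> M \<in> matchings E"
  by (simp add: matchings_def)

lemma matchings_subset: "M \<in> matchings E \<Longrightarrow> N \<subseteq> M \<Longrightarrow> N \<in> matchings F \<longleftrightarrow> N \<subseteq> F"
  unfolding matchings_def subset_iff mem_Collect_eq by meson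

lemma matchings_Un:
  assumes "M \<in> matchings E" "N \<in> matchings E" "\<Union>M \<inter> \<Union>N = {}"
  shows "M \<union> N \<in> matchings E"
proof (rule matchingsI)
  show "M \<union> N \<subseteq> E" using assms(1,2) by (auto dest: matchings_sub)
  fix e f assume ef: "e \<in> M \<union> N" "f \<in> M \<union> N" "e \<noteq> f"
  have "e \<inter> f = {}" if "e \<in> M" "f \<in> N" for e f using assms(3) that by blast
  then show "e \<inter> f = {}"
    using ef assms(1,2)[THEN matchings_disjoint, of e f] by blast
qed

lemma matchings_insert_iff:
  assumes "e \<notin> M"
  shows "insert e M \<in> matchings E \<longleftrightarrow> e \<in> E \<and> M \<in> matchings E \<and> e \<inter> \<Union>M = {}"
proof
  assume l: "insert e M \<in> matchings E"
  have "e \<inter> f = {}" if "f \<in> M" for f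
    using matchings_disjoint[OF l, of e f] that assms by auto
  moreover have "insert e M \<subseteq> E" using l by (rule matchings_sub)
  ultimately show "e \<in> E \<and> M \<in> matchings E \<and> e \<inter> \<Union>M = {}"
    using matchings_subset[OF l, of M E] by auto
next
  assume r: "e \<in> E \<and> M \<in> matchings E \<and> e \<inter> \<Union>M = {}"
  then have "{e} \<in> matchings E" by (auto simp: matchings_def)
  then have "{e} \<union> M \<in> matchings E" by (rule matchings_Un) (use r in auto)
  then show "insert e M \<in> matchings E" by simp
qed

lemma matchings_empty [simp]: "{} \<in> matchings E"
  by (simp add: matchings_def)

lemma finite_matchings: "finite E \<Longrightarrow> finite (matchings E)"
  by (rule finite_subset[of _ "Pow E"]) (auto simp: matchings_def)

lemma card_Union_matching:
  assumes "M \<in> matchings E" "finite E" "\<And>e. e \<in> E \<Longrightarrow> card e = 2"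
  shows "card (\<Union>M) = 2 * card M"
proof -
  have "card (\<Union>M) = (\<Sum>e\<in>M. card e)"
  proof (rule card_Union_disjoint)
    show "disjoint M" using assms(1) by (simp add: matchings_def disjoint_def)
    fix e assume "e \<in> M"
    then have "card e = 2" using assms(1,3) matchings_sub by blast
    then show "finite e" by (intro card_ge_0_finite) simp
  qed
  also have "\<dots> = (\<Sum>e\<in>M. 2)"
    using assms(3) matchings_sub[OF assms(1)] by (intro sum.cong) auto
  finally show ?thesis by simp
qed

text \<open>Since no edge of \<open>F\<close> crosses the boundary of \<open>K\<close>, one matching
  can be followed outside \<open>K\<close> and another inside. Nonempty edges keep the two parts
  from sharing an element.\<close>

lemma matching_exchange:
  assumes N: "N \<in> matchings F" "N' \<in> matchings F" and F: "finite F"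
    and K: "\<And>e. e \<in> F \<Longrightarrow> e \<noteq> {} \<and> (e \<subseteq> K \<or> e \<inter> K = {})"
  shows "{e \<in> N. e \<inter> K = {}} \<union> {e \<in> N'. e \<subseteq> K} \<in> matchings F"
    and "card ({e \<in> N. e \<inter> K = {}} \<union> {e \<in> N'. e \<subseteq> K}) =
      card {e \<in> N. e \<inter> K = {}} + card {e \<in> N'. e \<subseteq> K}"
proof -
  let ?A = "{e \<in> N. e \<inter> K = {}}" and ?B = "{e \<in> N'. e \<subseteq> K}"
  have A: "?A \<in> matchings F" "?B \<in> matchings F"
    using matchings_subset[OF N(1), of ?A F] matchings_subset[OF N(2), of ?B F]
      matchings_sub[OF N(1)] matchings_sub[OF N(2)] by auto
  moreover have "\<Union>?A \<inter> \<Union>?B = {}" by blast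
  ultimately show "?A \<union> ?B \<in> matchings F" by (rule matchings_Un)
  have "finite ?A" "finite ?B" using A[THEN matchings_sub] F finite_subset by blast+
  moreover have "?A \<inter> ?B = {}" using K matchings_sub[OF N(2)] by blast
  ultimately show "card (?A \<union> ?B) = card ?A + card ?B" by (rule card_Un_disjoint)
qed

lemma matchings_image:
  assumes f: "inj f"
  shows "matchings ((`) f ` E) = (`) ((`) f) ` matchings E"
proof (intro equalityI subsetI)
  fix M' assume M': "M' \<in> matchings ((`) f ` E)"
  define M where "M = {e \<in> E. f ` e \<in> M'}"
  have eq: "M' = (`) f ` M" using matchings_sub[OF M'] unfolding M_def by blast
  have "M \<in> matchings E"
  proof (rule matchingsI)
    fix d e assume "d \<in> M" "e \<in> M" "d \<noteq> e"
    then have "f ` d \<in> M'" "f ` e \<in> M'" "f ` d \<noteq> f ` e"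
      using f by (auto simp: M_def inj_image_eq_iff)
    then have "f ` d \<inter> f ` e = {}" by (rule matchings_disjoint[OF M'])
    then show "d \<inter> e = {}" by blast
  qed (auto simp: M_def)
  then show "M' \<in> (`) ((`) f) ` matchings E" using eq by blast
next
  fix M' assume "M' \<in> (`) ((`) f) ` matchings E"
  then obtain M where M: "M \<in> matchings E" "M' = (`) f ` M" by blast
  show "M' \<in> matchings ((`) f ` E)"
  proof (rule matchingsI)
    show "M' \<subseteq> (`) f ` E" using matchings_sub[OF M(1)] M(2) by blast
    fix d e assume "d \<in> M'" "e \<in> M'" "d \<noteq> e"
    then obtain d' e' where de: "d' \<in> M" "e' \<in> M" "d = f ` d'" "e = f ` e'" "d' \<noteq> e'"
      unfolding M(2) by blast
    have "d' \<inter> e' = {}" using matchings_disjoint[OF M(1) de(1,2,5)] .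
    then show "d \<inter> e = {}" unfolding de(3,4) image_Int[OF f, symmetric] by simp
  qed
qed

lemma card_image_image: "inj f \<Longrightarrow> card ((`) f ` M) = card M"
  by (intro card_image inj_onI) (simp add: inj_image_eq_iff)

lemma matching_number_eq: "matching_number G = Max (card ` matchings (uedges G))"
  by (simp add: matching_number_def matching_def matchings_def)

text \<open>For a matching this is the involution that swaps the ends of each edge. Uncovered
  vertices are its fixed points, which pick the diagonal entries in the determinant.\<close>

definition mate :: "'a set set \<Rightarrow> 'a \<Rightarrow> 'a" where
  "mate M v = (if v \<in> \<Union>M then THE u. {v, u} \<in> M else v)"

lemma mate_outside: "v \<notin> \<Union>M \<Longrightarrow> mate M v = v"
  by (simp add: mate_def)

lemma mate_eq:
  assumes "M \<in> matchings E" "{v, u} \<in> M"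
  shows "mate M v = u"
proof -
  have "(THE u. {v, u} \<in> M) = u"
  proof (rule the_equality)
    fix w assume "{v, w} \<in> M"
    then have "{v, w} = {v, u}" using matchings_disjoint[OF assms(1) _ assms(2), of "{v, w}"] by blast
    then show "w = u" by (auto simp: doubleton_eq_iff)
  qed (rule assms)
  then show ?thesis using assms(2) by (auto simp: mate_def)
qed

lemma mate_in:
  assumes "M \<in> matchings E" "\<And>e. e \<in> E \<Longrightarrow> card e = 2" "v \<in> \<Union>M"
  shows "{v, mate M v} \<in> M" "mate M v \<noteq> v"
proof -
  obtain e where e: "e \<in> M" "v \<in> e" using assms(3) by blast
  then have "card e = 2" using assms(1,2) by (auto simp: matchings_def)
  then obtain u where "e = {v, u}" "u \<noteq> v" using e(2) by (auto simp: card_2_iff)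
  then show "{v, mate M v} \<in> M" "mate M v \<noteq> v"
    using mate_eq[OF assms(1), of v u] e(1) by auto
qed

lemma mate_mate:
  assumes "M \<in> matchings E" "\<And>e. e \<in> E \<Longrightarrow> card e = 2"
  shows "mate M (mate M v) = v"
proof (cases "v \<in> \<Union>M")
  case True
  then have "{mate M v, v} \<in> M" using mate_in(1)[OF assms True] by (simp add: insert_commute)
  then show ?thesis using mate_eq[OF assms(1)] by blast
qed (simp add: mate_outside)

lemma mate_permutes:
  assumes "M \<in> matchings E" "\<And>e. e \<in> E \<Longrightarrow> card e = 2" "\<Union>M \<subseteq> S"
  shows "mate M permutes S"
proof -
  have "bij (mate M)"
    using mate_mate[OF assms(1,2)] by (intro involuntory_imp_bij) 
  moreover have "mate M x = x" if "x \<notin> S" for x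
    using that assms(3) by (intro mate_outside) auto
  ultimately show ?thesis by (simp add: permutes_def bij_iff)
qed

text \<open>The involution is a product of disjoint transpositions, one for each edge of the
  matching.\<close>

lemma sign_mate:
  assumes "M \<in> matchings E" "\<And>e. e \<in> E \<Longrightarrow> card e = 2" "finite M"
  shows "sign (mate M) = (- 1) ^ card M"
  using assms(3,1)
proof (induction M rule: finite_induct)
  case empty
  have "mate {} = (id :: 'a \<Rightarrow> 'a)" by (auto simp: mate_outside)
  then show ?case by (simp add: sign_id)
next
  case (insert e M)
  then have M: "M \<in> matchings E" "e \<in> E" "e \<inter> \<Union>M = {}"
    by (auto simp: matchings_insert_iff)
  then obtain u v where e: "e = {u, v}" "u \<noteq> v" using assms(2)[of e] by (auto simp: card_2_iff)
  have fin: "finite (\<Union>M)"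
  proof (rule finite_Union)
    fix f assume "f \<in> M"
    then have "card f = 2" using matchings_sub[OF M(1)] assms(2) by blast
    then show "finite f" by (intro card_ge_0_finite) simp
  qed (rule insert.hyps)
  have "mate (insert e M) = transpose u v \<circ> mate M"
  proof
    fix x
    consider "x = u" | "x = v" | "x \<in> \<Union>M" "x \<noteq> u" "x \<noteq> v" | "x \<notin> \<Union>(insert e M)"
      using e by auto
    then show "mate (insert e M) x = (transpose u v \<circ> mate M) x"
    proof cases
      case 1
      then have "mate M x = x" using M(3) e by (intro mate_outside) auto
      moreover have "mate (insert e M) x = v"
        by (rule mate_eq[OF insert.prems]) (use 1 e in simp)
      ultimately show ?thesis using 1 by simp
    next
      case 2
      then have "mate M x = x" using M(3) e by (intro mate_outside) auto
      moreover have "mate (insert e M) x = u"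
        by (rule mate_eq[OF insert.prems]) (use 2 e in \<open>simp add: insert_commute\<close>)
      ultimately show ?thesis using 2 by simp
    next
      case 3
      then have m: "{x, mate M x} \<in> M" using mate_in(1)[OF M(1) assms(2)] by blast
      then have "mate (insert e M) x = mate M x" by (intro mate_eq[OF insert.prems]) simp
      moreover have "mate M x \<noteq> u" "mate M x \<noteq> v" using m M(3) e by auto
      ultimately show ?thesis by simp
    next
      case 4
      then show ?thesis using e by (simp add: mate_outside)
    qed
  qed
  moreover have "permutation (mate M)"
    using mate_permutes[OF M(1) assms(2) order.refl] fin by (auto intro: permutation_permutes[THEN iffD2])
  ultimately have "sign (mate (insert e M)) = - sign (mate M)"
    using e by (simp add: sign_compose permutation_swap_id sign_swap_id)
  then show ?case using insert M by simp
qed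

text \<open>The inverse collects the pairs \<open>{v, p v}\<close> of moved vertices; for an
  involution two such pairs are equal or disjoint.\<close>

lemma bij_betw_mate:
  assumes E: "\<And>e. e \<in> E \<Longrightarrow> card e = 2"
  shows "bij_betw mate (matchings E) {p. (\<forall>v. p (p v) = v) \<and> (\<forall>v. p v \<noteq> v \<longrightarrow> {v, p v} \<in> E)}"
    (is "bij_betw _ _ ?I")
  unfolding bij_betw_def
proof
  show "inj_on mate (matchings E)"
  proof (rule inj_onI)
    have sub: "M \<subseteq> N" if M: "M \<in> matchings E" "N \<in> matchings E" "mate M = mate N" for M N
    proof
      fix e assume e: "e \<in> M"
      then have "card e = 2" using M E by (auto simp: matchings_def)
      then obtain u v where uv: "e = {u, v}" "u \<noteq> v" by (auto simp: card_2_iff)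
      then have m: "mate M u = v" using mate_eq[OF M(1)] e by blast
      then have "u \<in> \<Union>N" using M(3) uv(2) mate_outside by metis
      then have "{u, mate N u} \<in> N" using mate_in[OF M(2) E] by blast
      then show "e \<in> N" using uv m M(3) by simp
    qed
    fix M N assume "M \<in> matchings E" "N \<in> matchings E" "mate M = mate N"
    then show "M = N" using sub[of M N] sub[of N M] by auto
  qed
  show "mate ` matchings E = ?I"
  proof (intro equalityI subsetI)
    fix p assume "p \<in> mate ` matchings E"
    then obtain M where M: "M \<in> matchings E" "p = mate M" by blast
    have "{v, mate M v} \<in> E" if "mate M v \<noteq> v" for v
    proof -
      have "v \<in> \<Union>M" using that mate_outside by metis
      then show ?thesis using mate_in(1)[OF M(1) E] M(1) by (auto simp: matchings_def)
    qed
    then show "p \<in> ?I" using mate_mate[OF M(1) E] M(2) by simp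
  next
    fix p assume p: "p \<in> ?I"
    define M where "M = (\<lambda>v. {v, p v}) ` {v. p v \<noteq> v}"
    have M: "M \<in> matchings E"
    proof (rule matchingsI)
      show "M \<subseteq> E" using p by (auto simp: M_def)
      have inv: "p (p v) = v" for v using p by simp
      fix e f assume "e \<in> M" "f \<in> M" "e \<noteq> f"
      then obtain u v where uv: "e = {u, p u}" "f = {v, p v}" "{u, p u} \<noteq> {v, p v}"
        by (auto simp: M_def)
      then have "\<not> (u = v \<and> p u = p v)" "\<not> (u = p v \<and> p u = v)"
        unfolding doubleton_eq_iff by blast+
      then have "u \<noteq> v" "u \<noteq> p v" "p u \<noteq> v" "p u \<noteq> p v"
        using inv by metis+
      then show "e \<inter> f = {}" using uv by auto
    qed
    have "mate M v = p v" for v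
    proof (cases "p v = v")
      case False
      then show ?thesis by (intro mate_eq[OF M]) (auto simp: M_def)
    next
      case True
      have "v \<notin> \<Union>M"
      proof
        assume "v \<in> \<Union>M"
        then obtain w where "p w \<noteq> w" "v = w \<or> v = p w" by (auto simp: M_def)
        then show False using True p by auto
      qed
      then show ?thesis using True by (simp add: mate_outside)
    qed
    then have "p = mate M" by auto
    then show "p \<in> mate ` matchings E" using M by blast
  qed
qed

text \<open>Each edge is met from both of its ends, so its weight enters squared and disappears.
  This is why the signs do not affect the matching part of the expansion.\<close>

lemma prod_mate:
  fixes s :: "'a set \<Rightarrow> 'b::comm_ring_1" and x :: 'b
  assumes M: "M \<in> matchings E" and E: "finite E" "\<And>e. e \<in> E \<Longrightarrow> card e = 2"
    and s: "\<And>e. e \<in> E \<Longrightarrow> s e * s e = 1"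
    and S: "finite S" "\<Union>M \<subseteq> S"
  shows "(\<Prod>v\<in>S. if mate M v = v then x else s {v, mate M v}) = x ^ (card S - 2 * card M)"
    (is "prod ?f S = _")
proof -
  have fin: "finite (\<Union>M)" using S finite_subset by blast
  have "prod ?f S = prod ?f (S - \<Union>M) * prod ?f (\<Union>M)"
    by (rule prod.subset_diff[OF S(2,1)])
  also have "prod ?f (S - \<Union>M) = (\<Prod>v\<in>S - \<Union>M. x)"
    by (intro prod.cong) (auto simp: mate_outside)
  also have "\<dots> = x ^ (card S - 2 * card M)"
    using card_Diff_subset[OF fin S(2)] card_Union_matching[OF M E] by simp
  also have "prod ?f (\<Union>M) = (\<Prod>e\<in>M. prod ?f e)"
  proof (rule prod.Union_disjoint[unfolded comp_def])
    show "\<forall>A\<in>M. finite A" using fin by (meson Union_upper finite_subset)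
    show "\<forall>A\<in>M. \<forall>B\<in>M. A \<noteq> B \<longrightarrow> A \<inter> B = {}" using M by (auto simp: matchings_def)
  qed
  also have "\<dots> = 1"
  proof (rule prod.neutral, rule ballI)
    fix e assume e: "e \<in> M"
    then have "e \<in> E" using M by (auto simp: matchings_def)
    then obtain u v where uv: "e = {u, v}" "u \<noteq> v" using E(2)[of e] by (auto simp: card_2_iff)
    have "mate M u = v" "mate M v = u"
      using e uv mate_eq[OF M, of u v] mate_eq[OF M, of v u] by (auto simp: insert_commute)
    then show "prod ?f e = 1"
      using uv s[OF \<open>e \<in> E\<close>] by (auto simp: insert_commute)
  qed
  finally show ?thesis by simp
qed

section \<open>Auxiliary facts on polynomials and signs of cycles\<close>

lemma coeff_minus_one_power_mult: "coeff ((- 1) ^ c * p) i = (- 1) ^ c * coeff (p :: 'a::comm_ring_1 poly) i"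
  by (induction c) simp_all

lemma order_0_eqI:
  assumes "coeff p k \<noteq> 0" "\<And>i. i < k \<Longrightarrow> coeff p i = 0"
  shows "Polynomial.order 0 p = (k :: nat)"
proof -
  have p: "p \<noteq> 0" using assms(1) by auto
  have "j \<le> Polynomial.order 0 p \<longleftrightarrow> j \<le> k" for j
    unfolding monom_1_dvd_iff[OF p, symmetric] monom_1_dvd_iff' using assms
    by (meson le_less_trans less_le_trans not_le)
  then show ?thesis by (meson antisym order_refl)
qed

lemma sign_cycle_of_list: "distinct cs \<Longrightarrow> sign (cycle_of_list cs) = (- 1) ^ (length cs - 1)"
proof (induction cs rule: cycle_of_list.induct)
  case (1 i j cs)
  have "sign (cycle_of_list (i # j # cs)) = sign (Transposition.transpose i j) * sign (cycle_of_list (j # cs))"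
    unfolding cycle_of_list.simps(1) by (rule sign_compose[OF permutation_swap_id permutation_of_cycle])
  then show ?case using 1 by (simp add: sign_swap_id del: cycle_of_list.simps)
qed (auto simp: sign_id)

section \<open>Permutations along the edges\<close>

text \<open>Arcs are replaced by two-element edges, as the counting concerns undirected objects.
  Uniqueness compares edge sets because rotations and reversals of \<open>xs\<close> list the same
  cycle.\<close>

locale unicyclic_edges =
  fixes V :: "'a set" and E :: "'a set set" and xs :: "'a list"
  assumes finV: "finite V"
    and E_sub: "\<And>e. e \<in> E \<Longrightarrow> e \<subseteq> V"
    and E_card: "\<And>e. e \<in> E \<Longrightarrow> card e = 2"
    and xs_path: "closed_path {(u, v). {u, v} \<in> E} xs"
    and unique: "\<And>ys. closed_path {(u, v). {u, v} \<in> E} ys \<Longrightarrow> closed_path_edges ys = closed_path_edges xs"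
begin

abbreviation "q \<equiv> length xs"
abbreviation "W \<equiv> set xs"
abbreviation "C \<equiv> closed_path_edges xs"
abbreviation "rot \<equiv> cycle_of_list xs"
abbreviation "unrot \<equiv> inv_into UNIV rot"

text \<open>The edge set of G - V(C).\<close>

definition D :: "'a set set" where "D = {e \<in> E. e \<inter> W = {}}"

lemma finE: "finite E"
  using E_sub finV by (intro finite_subset[of E "Pow V"]) auto

lemma D_sub: "D \<subseteq> E" by (auto simp: D_def)

lemma finD: "finite D" using finE D_sub finite_subset by blast

lemma xs_distinct: "distinct xs" and q_ge: "3 \<le> q"
  and xs_edge: "\<And>i. i < q \<Longrightarrow> {xs ! i, xs ! (Suc i mod q)} \<in> E"
  using xs_path by (auto simp: closed_path_def)

lemma C_sub: "C \<subseteq> E"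
  using xs_edge by (auto simp: closed_path_edges_def)

lemma rot_funpow_nth: 
  assumes "i < q"
  shows "(rot ^^ n) (xs ! i) = xs ! ((n + i) mod q)"
  using arg_cong[OF cyclic_rotation[OF xs_distinct, of n], of "\<lambda>l. l ! i"] assms
  by (simp add: nth_rotate)

lemma rot_nth: "i < q \<Longrightarrow> rot (xs ! i) = xs ! (Suc i mod q)"
  using rot_funpow_nth[of i 1] by simp

lemma rot_permutes: "rot permutes W"
  by (rule cycle_permutes)

lemma rot_in: "v \<in> W \<Longrightarrow> rot v \<in> W"
  using permutes_in_image[OF rot_permutes] by blast

text \<open>Length at least 3 enters here. It makes the two directions of rotation different and
  keeps rotations apart from involutions.\<close>

lemma rot_rot_neq:
  assumes "v \<in> W" shows "rot (rot v) \<noteq> v" "rot v \<noteq> v"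
proof -
  obtain i where i: "i < q" "v = xs ! i" using assms by (auto simp: in_set_conv_nth)
  have "(2 + i) mod q \<noteq> i" "(1 + i) mod q \<noteq> i"
    using i(1) q_ge by (auto simp: mod_if)
  moreover have "(rot ^^ 2) v = xs ! ((2 + i) mod q)" "(rot ^^ 1) v = xs ! ((1 + i) mod q)"
    unfolding i(2) by (intro rot_funpow_nth i(1))+
  moreover have "(2 + i) mod q < q" "(1 + i) mod q < q"
    using q_ge by (auto intro!: mod_less_divisor)
  ultimately show "rot (rot v) \<noteq> v" "rot v \<noteq> v"
    using xs_distinct i by (auto simp: numeral_2_eq_2 nth_eq_iff_index_eq)
qed

lemma rot_orbit:
  assumes "v \<in> W" "w \<in> W"
  obtains n where "w = (rot ^^ n) v"
proof -
  obtain i j where ij: "i < q" "v = xs ! i" "j < q" "w = xs ! j"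
    using assms by (auto simp: in_set_conv_nth)
  have "(rot ^^ (q - i + j)) v = xs ! ((q - i + j + i) mod q)"
    using rot_funpow_nth[OF ij(1)] ij(2) by simp
  also have "(q - i + j + i) mod q = j" using ij by simp
  finally show ?thesis using that ij by metis
qed

lemma C_eq: "C = (\<lambda>v. {v, rot v}) ` W"
proof -
  have "W = (!) xs ` {..<q}" by (auto simp: set_conv_nth)
  then show ?thesis
    unfolding closed_path_edges_def by (simp add: image_image rot_nth)
qed

lemma inj_on_C: "inj_on (\<lambda>v. {v, rot v}) W"
proof (rule inj_onI)
  fix u v assume "u \<in> W" "v \<in> W" "{u, rot u} = {v, rot v}"
  then show "u = v" using rot_rot_neq(1)[of u] by (auto simp: doubleton_eq_iff)
qed

lemma card_C: "card C = q"
  unfolding C_eq card_image[OF inj_on_C] by (rule distinct_card[OF xs_distinct])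

lemma Union_C: "\<Union>C = W"
  unfolding C_eq using rot_in by auto

lemma W_sub: "W \<subseteq> V"
  using Union_C C_sub E_sub by blast

text \<open>The orbit of \<open>v\<close> has neither one nor two elements, as
  \<open>p (p v)\<close> differs from \<open>v\<close>, and each step follows an edge. So the orbit
  is a closed path, and by uniqueness it runs around \<open>C\<close>.\<close>

lemma noninvolution_orbit:
  assumes p: "p permutes V" "\<forall>v. p v \<noteq> v \<longrightarrow> {v, p v} \<in> E" and v: "p (p v) \<noteq> v"
  shows "v \<in> W" and "\<And>w. w \<in> W \<Longrightarrow> p (p w) \<noteq> w \<and> {w, p w} \<in> C"
proof -
  have perm: "permutation p" using p(1) finV by (auto simp: permutation_permutes)
  have inj: "inj (p ^^ n)" for n
    using permutes_inj[OF p(1)] by (rule inj_fn)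
  let ?k = "least_power p v"
  define ys where "ys = support p v"
  have len: "length ys = ?k" by (simp add: ys_def)
  have nth: "ys ! i = (p ^^ i) v" if "i < ?k" for i using that by (simp add: ys_def)
  have pv: "p v \<noteq> v" using v by auto
  have k: "(p ^^ ?k) v = v" "?k > 0" using least_power_of_permutation[OF perm] by auto
  have "?k \<noteq> 1" "?k \<noteq> 2"
    using k(1) pv v by (auto simp: numeral_2_eq_2)
  then have k3: "3 \<le> ?k" using k(2) by linarith
  have move: "p ((p ^^ n) v) \<noteq> (p ^^ n) v" for n
    using inj[of n] pv by (metis funpow_swap1 injD)
  have move2: "p (p ((p ^^ n) v)) \<noteq> (p ^^ n) v" for n
    using inj[of n] v by (metis funpow_swap1 injD)
  have next_nth: "ys ! (Suc i mod ?k) = p (ys ! i)" if "i < ?k" for i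
  proof (cases "Suc i = ?k")
    case True
    then have "p ((p ^^ i) v) = v" using k(1) by (metis comp_apply funpow.simps(2))
    then show ?thesis using True that nth k(2) by simp
  next
    case False
    then show ?thesis using that nth by simp
  qed
  have edge: "{ys ! i, p (ys ! i)} \<in> E" if "i < ?k" for i
    using p(2) move[of i] nth[OF that] by simp
  have "closed_path {(u, v). {u, v} \<in> E} ys"
    unfolding closed_path_def len
    using k3 edge next_nth cycle_of_permutation[OF perm, of v] by (simp add: ys_def[symmetric])
  then have C: "closed_path_edges ys = C" by (rule unique)
  have C': "C = (\<lambda>i. {ys ! i, p (ys ! i)}) ` {..<?k}"
  proof -
    have "closed_path_edges ys = (\<lambda>i. {ys ! i, p (ys ! i)}) ` {..<?k}"
      unfolding closed_path_edges_def len using next_nth by (intro image_cong) auto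
    then show ?thesis using C by simp
  qed
  have sub: "set ys \<subseteq> W"
  proof
    fix y assume "y \<in> set ys"
    then obtain i where "i < ?k" "y = ys ! i" by (auto simp: in_set_conv_nth len)
    then have "y \<in> \<Union>C" unfolding C' by auto
    then show "y \<in> W" unfolding Union_C .
  qed
  have sub2: "W \<subseteq> set ys"
  proof
    fix y assume "y \<in> W"
    then have "y \<in> \<Union>C" unfolding Union_C .
    then obtain i where i: "i < ?k" "y = ys ! i \<or> y = p (ys ! i)" unfolding C' by auto
    then have "y = ys ! i \<or> y = ys ! (Suc i mod ?k)" using next_nth by simp
    then show "y \<in> set ys" using i(1) k(2) len by (metis mod_less_divisor nth_mem)
  qed
  have "v = ys ! 0" using nth[of 0] k(2) by simp
  then show "v \<in> W" using sub k(2) len by (metis nth_mem subsetD)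
  fix w assume "w \<in> W"
  then obtain i where i: "i < ?k" "w = ys ! i" using sub2 by (metis in_set_conv_nth len subsetD)
  then show "p (p w) \<noteq> w \<and> {w, p w} \<in> C"
    using move2[of i] nth[OF i(1)] unfolding C' by (intro conjI image_eqI[of _ _ i]) auto
qed

lemma bij_mate_D:
  "bij_betw mate (matchings D) {p. (\<forall>v. p (p v) = v) \<and> (\<forall>v. p v \<noteq> v \<longrightarrow> {v, p v} \<in> D)}"
  using D_sub E_card by (intro bij_betw_mate) blast

text \<open>On \<open>W\<close> the permutation moves along cycle edges in one constant direction.
  Off \<open>W\<close> it is an involution, since every vertex that violates this lies on the
  cycle.\<close>

lemma noninvolution_eq:
  assumes p: "p permutes V" "\<forall>v. p v \<noteq> v \<longrightarrow> {v, p v} \<in> E" and v: "p (p v) \<noteq> v"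
  obtains s N where "s \<in> {rot, unrot}" "N \<in> matchings D" "p = s \<circ> mate N"
proof -
  note orb = noninvolution_orbit[OF p v]
  have rinj: "rot a = rot b \<longleftrightarrow> a = b" for a b
    using permutes_inj[OF rot_permutes] by (auto dest: injD)
  have pinj: "p a = p b \<longleftrightarrow> a = b" for a b
    using permutes_inj[OF p(1)] by (auto dest: injD)
  have alt: "p w = rot w \<or> rot (p w) = w" if "w \<in> W" for w
  proof -
    have "{w, p w} \<in> C" using orb(2)[OF that] by blast
    then obtain u where "{w, p w} = {u, rot u}" unfolding C_eq by blast
    then show ?thesis by (auto simp: doubleton_eq_iff)
  qed
  have pW: "p w \<in> W" if "w \<in> W" for w
  proof -
    have "p w \<in> \<Union>C" using orb(2)[OF that] by blast
    then show ?thesis unfolding Union_C .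
  qed
  have "\<exists>s\<in>{rot, unrot}. \<forall>w\<in>W. p w = s w"
  proof (cases "\<exists>w\<in>W. p w = rot w")
    case True
    then obtain w where w: "w \<in> W" "p w = rot w" by blast
    \<comment> \<open>The direction never reverses: stepping back from \<open>rot y\<close> would
      give \<open>p (p y) = y\<close>.\<close>
    have it: "(rot ^^ n) w \<in> W \<and> p ((rot ^^ n) w) = rot ((rot ^^ n) w)" for n
    proof (induction n)
      case (Suc n)
      let ?y = "(rot ^^ n) w"
      have y: "?y \<in> W" "p ?y = rot ?y" using Suc by auto
      then have "rot ?y \<in> W" using rot_in by blast
      moreover have "rot (p (rot ?y)) \<noteq> rot ?y"
        using orb(2)[OF y(1)] y(2) rinj by metis
      ultimately show ?case using alt[of "rot ?y"] by simp
    qed (use w in simp)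
    have "p u = rot u" if "u \<in> W" for u
      using rot_orbit[OF w(1) that] it by metis
    then show ?thesis by blast
  next
    case False
    then have "p w = unrot w" if "w \<in> W" for w
      using alt[OF that] that permutes_inverses(2)[OF rot_permutes] by metis
    then show ?thesis by blast
  qed
  then obtain s where s: "s \<in> {rot, unrot}" "\<And>w. w \<in> W \<Longrightarrow> p w = s w" by blast
  have sp: "s permutes W" using s(1) rot_permutes permutes_inv by blast
  have pW': "p w \<notin> W" if "w \<notin> W" for w
  proof
    assume "p w \<in> W"
    then obtain u where u: "u \<in> W" "p w = s u"
      using permutes_image[OF sp] by (metis imageE)
    then have "p w = p u" using s(2) by simp
    then show False using pinj u(1) that by simp
  qed
  \<comment> \<open>Dividing out the rotation leaves a map that fixes \<open>W\<close> pointwise and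
    agrees with \<open>p\<close> elsewhere.\<close>
  define n where "n = inv_into UNIV s \<circ> p"
  have nW: "n w = w" if "w \<in> W" for w
    using that s(2) permutes_inverses(2)[OF sp] by (simp add: n_def)
  have n_out: "n w = p w" if "w \<notin> W" for w
    using permutes_not_in[OF permutes_inv[OF sp] pW'[OF that]] by (simp add: n_def)
  have "n \<in> {p. (\<forall>v. p (p v) = v) \<and> (\<forall>v. p v \<noteq> v \<longrightarrow> {v, p v} \<in> D)}"
  proof (intro CollectI conjI allI impI)
    fix w show "n (n w) = w"
    proof (cases "w \<in> W")
      case False
      then show ?thesis using noninvolution_orbit(1)[OF p, of w] n_out pW' by metis
    qed (simp add: nW)
  next
    fix w assume "n w \<noteq> w"
    then have "w \<notin> W" using nW by blast
    then show "{w, n w} \<in> D"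
      using \<open>n w \<noteq> w\<close> n_out[of w] p(2) pW'[of w] by (simp add: D_def)
  qed
  then obtain N where N: "N \<in> matchings D" "n = mate N"
    unfolding bij_betw_imp_surj_on[OF bij_mate_D, symmetric] by blast
  have "p = s \<circ> mate N"
    unfolding N(2)[symmetric] n_def using permutes_inverses(1)[OF sp] by auto
  then show ?thesis using that s(1) N(1) by blast
qed

lemma matching_D_avoids: "N \<in> matchings D \<Longrightarrow> \<Union>N \<subseteq> V - W"
  using matchings_sub[of N D] E_sub by (force simp: D_def)

lemma mate_D_W: "N \<in> matchings D \<Longrightarrow> w \<in> W \<Longrightarrow> mate N w = w"
  using matching_D_avoids[of N] by (intro mate_outside) blast

definition cyclic_perms :: "('a \<Rightarrow> 'a) set" where
  "cyclic_perms = (\<lambda>(s, N). s \<circ> mate N) ` ({rot, unrot} \<times> matchings D)"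

lemma cyclic_perms_iff:
  "p \<in> cyclic_perms \<longleftrightarrow> (\<exists>s\<in>{rot, unrot}. \<exists>N\<in>matchings D. p = s \<circ> mate N)"
  unfolding cyclic_perms_def image_iff split_paired_Bex_Sigma prod.case by (rule refl)

lemma inv_rot_neq: "w \<in> W \<Longrightarrow> unrot w \<noteq> rot w"
  using rot_rot_neq(1)[of w] permutes_inverses(1)[OF rot_permutes, of w] by metis

lemma rot_neq_inv: "rot \<noteq> unrot"
proof -
  have "xs ! 0 \<in> W" using q_ge by (intro nth_mem) auto
  then show ?thesis using inv_rot_neq by metis
qed

text \<open>The value at a cycle vertex, which every \<open>mate N\<close> fixes, determines the
  direction; cancelling the rotation then determines \<open>N\<close>.\<close>

lemma inj_on_cyclic_perms: "inj_on (\<lambda>(s, N). s \<circ> mate N) ({rot, unrot} \<times> matchings D)"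
proof (rule inj_onI)
  fix a b assume a: "a \<in> {rot, unrot} \<times> matchings D" and b: "b \<in> {rot, unrot} \<times> matchings D"
    and eq: "(case a of (s, N) \<Rightarrow> s \<circ> mate N) = (case b of (s, N) \<Rightarrow> s \<circ> mate N)"
  obtain s N s' N' where ab: "a = (s, N)" "b = (s', N')" by (cases a, cases b)
  then have s: "s \<in> {rot, unrot}" "s' \<in> {rot, unrot}" and N: "N \<in> matchings D" "N' \<in> matchings D"
    using a b by auto
  have e: "s (mate N w) = s' (mate N' w)" for w using fun_cong[OF eq, of w] ab by simp
  have w: "xs ! 0 \<in> W" using q_ge by (intro nth_mem) auto
  have "s (xs ! 0) = s' (xs ! 0)" using e[of "xs ! 0"] mate_D_W[OF _ w] N by simp
  then have ss: "s = s'" using s inv_rot_neq[OF w] by fastforce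
  have sp: "s permutes W" using s(1) rot_permutes permutes_inv by blast
  have "mate N = mate N'"
    using e ss injD[OF permutes_inj[OF sp]] by (intro ext) blast
  moreover have "inj_on mate (matchings D)"
    by (rule bij_betw_imp_inj_on[OF bij_mate_D])
  ultimately show "a = b" using N ss ab by (auto dest: inj_onD)
qed

text \<open>The two classes are told apart by whether \<open>p\<close> is an involution, which no
  rotation of at least three vertices is.\<close>

lemma edge_permutations:
  "{p. p permutes V \<and> (\<forall>v. p v \<noteq> v \<longrightarrow> {v, p v} \<in> E)} = mate ` matchings E \<union> cyclic_perms" (is "?L = ?R")
  and disjoint_perms: "mate ` matchings E \<inter> cyclic_perms = {}"
proof -
  have inv: "mate ` matchings E = {p. (\<forall>v. p (p v) = v) \<and> (\<forall>v. p v \<noteq> v \<longrightarrow> {v, p v} \<in> E)}"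
    using bij_betw_mate[OF E_card] by (auto simp: bij_betw_def)
  have cyc: "p permutes V \<and> (\<forall>v. p v \<noteq> v \<longrightarrow> {v, p v} \<in> E) \<and> (\<exists>v. p (p v) \<noteq> v)"
    if c: "p \<in> cyclic_perms" for p
  proof -
    obtain s N where s: "s \<in> {rot, unrot}" and N: "N \<in> matchings D" and p: "p = s \<circ> mate N"
      using c unfolding cyclic_perms_iff by meson
    have sp: "s permutes W" using s rot_permutes permutes_inv by blast
    have NE: "N \<in> matchings E" using N matchings_mono[OF D_sub] by blast
    have mp: "mate N permutes V"
      using matching_D_avoids[OF N] by (intro mate_permutes[OF NE E_card]) auto
    have "p permutes V"
      unfolding p by (rule permutes_compose[OF mp permutes_subset[OF sp W_sub]])
    moreover have "{v, p v} \<in> E" if "p v \<noteq> v" for v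
    proof (cases "v \<in> W")
      case True
      then have pv: "p v = s v" using p mate_D_W[OF N] by simp
      have "{v, s v} \<in> C"
      proof (cases "s = rot")
        case False
        then have "s v = unrot v" using s by auto
        then have "rot (s v) = v" using permutes_inverses(1)[OF rot_permutes, of v] by simp
        moreover have "s v \<in> W" using permutes_in_image[OF sp, of v] True by blast
        ultimately show ?thesis unfolding C_eq by (intro image_eqI[of _ _ "s v"]) (simp_all add: insert_commute)
      qed (use True in \<open>auto simp: C_eq\<close>)
      then show ?thesis using pv C_sub by auto
    next
      case False
      have m: "mate N v \<notin> W"
      proof
        assume "mate N v \<in> W"
        then have "mate N (mate N v) = mate N v" by (rule mate_D_W[OF N])
        then show False using mate_mate[OF NE E_card, of v] \<open>mate N v \<in> W\<close> False by simp
      qed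
      then have pv: "p v = mate N v" unfolding p using permutes_not_in[OF sp] by simp
      have "v \<in> \<Union>N"
      proof (rule ccontr)
        assume "v \<notin> \<Union>N"
        then have "mate N v = v" by (rule mate_outside)
        then show False using that pv by simp
      qed
      then have "{v, mate N v} \<in> N" using mate_in(1)[OF NE E_card] by blast
      then show ?thesis unfolding pv using matchings_sub[OF NE] by (rule rev_subsetD)
    qed
    moreover have "\<exists>v. p (p v) \<noteq> v"
    proof -
      have w: "xs ! 0 \<in> W" using q_ge by (intro nth_mem) auto
      then have sw: "s (xs ! 0) \<in> W" using permutes_in_image[OF sp] by blast
      have "s (s (xs ! 0)) \<noteq> xs ! 0"
      proof (cases "s = rot")
        case True
        then show ?thesis using rot_rot_neq(1)[OF w] by simp
      next
        case False
        then have "s = unrot" using s by auto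
        then have "rot (rot (s (s (xs ! 0)))) = xs ! 0"
          using permutes_inverses(1)[OF rot_permutes] by simp
        then show ?thesis using rot_rot_neq(1)[OF w] by auto
      qed
      then show ?thesis unfolding p using w sw mate_D_W[OF N] by (intro exI[of _ "xs ! 0"]) simp
    qed
    ultimately show ?thesis by (intro conjI allI impI)
  qed
  show "mate ` matchings E \<inter> cyclic_perms = {}"
    using cyc unfolding inv by blast
  show "?L = ?R"
  proof (intro equalityI subsetI)
    fix p assume p: "p \<in> ?L"
    show "p \<in> ?R"
    proof (cases "\<forall>v. p (p v) = v")
      case True
      then show ?thesis using p unfolding inv by blast
    next
      case False
      then obtain v where v: "p (p v) \<noteq> v" by blast
      have pp: "p permutes V" "\<forall>v. p v \<noteq> v \<longrightarrow> {v, p v} \<in> E" using p by simp_all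
      have "p \<in> cyclic_perms"
        by (rule noninvolution_eq[OF pp v]) (unfold cyclic_perms_iff, intro bexI)
      then show ?thesis ..
    qed
  next
    fix p assume "p \<in> ?R"
    then show "p \<in> ?L"
    proof
      assume "p \<in> mate ` matchings E"
      then obtain M where M: "M \<in> matchings E" "p = mate M" by blast
      have "\<Union>M \<subseteq> V" using matchings_sub[OF M(1)] E_sub by blast
      then have "p permutes V" unfolding M(2) using mate_permutes[OF M(1) E_card] by blast
      then show ?thesis using M inv by blast
    qed (use cyc in blast)
  qed
qed

text \<open>\<open>b\<close> models the entries of xI - A with \<open>t\<close> in place of the
  negated signs; the ring is kept general so that the entries may be polynomials. The factor 2
  arises because both directions have the same sign and the same product of entries.\<close>

lemma permutation_sum:
  fixes x :: "'b::comm_ring_1" and t :: "'a set \<Rightarrow> 'b"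
  assumes t: "\<And>e. e \<in> E \<Longrightarrow> t e * t e = 1"
  defines "b \<equiv> \<lambda>u v. if u = v then x else if {u, v} \<in> E then t {u, v} else 0"
  shows "(\<Sum>p | p permutes V. of_int (sign p) * (\<Prod>v\<in>V. b v (p v))) =
    (\<Sum>M\<in>matchings E. (- 1) ^ card M * x ^ (card V - 2 * card M)) +
    2 * ((- 1) ^ (q - 1) * (\<Prod>e\<in>C. t e)) *
      (\<Sum>N\<in>matchings D. (- 1) ^ card N * x ^ (card V - q - 2 * card N))"
    (is "_ = ?A + ?B")
proof -
  let ?f = "\<lambda>p. of_int (sign p) * (\<Prod>v\<in>V. b v (p v)) :: 'b"
  let ?P = "{p. p permutes V \<and> (\<forall>v. p v \<noteq> v \<longrightarrow> {v, p v} \<in> E)}"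
  have fin: "finite {p. p permutes V}" by (rule finite_permutations[OF finV])
  have "?f p = 0" if p: "p \<in> {p. p permutes V} - ?P" for p
  proof -
    obtain v where v: "p v \<noteq> v" "{v, p v} \<notin> E" using p by blast
    have "v \<in> V" using p v(1) permutes_not_in by fastforce
    moreover have "b v (p v) = 0" using v by (simp add: b_def)
    ultimately have "(\<Prod>v\<in>V. b v (p v)) = 0" using finV by (intro prod_zero) auto
    then show ?thesis by simp
  qed
  then have "sum ?f {p. p permutes V} = sum ?f ?P"
    by (intro sum.mono_neutral_right[OF fin]) auto
  also have "\<dots> = sum ?f (mate ` matchings E) + sum ?f cyclic_perms"
  proof -
    have "finite ?P" by (rule finite_subset[OF _ fin]) auto
    then have "finite (mate ` matchings E)" "finite cyclic_perms"
      unfolding edge_permutations by simp_all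
    then show ?thesis
      unfolding edge_permutations by (intro sum.union_disjoint disjoint_perms)
  qed
  also have "sum ?f (mate ` matchings E) = ?A"
  proof -
    have inj: "inj_on mate (matchings E)" using bij_betw_mate[OF E_card] by (auto simp: bij_betw_def)
    have "?f (mate M) = (- 1) ^ card M * x ^ (card V - 2 * card M)" if M: "M \<in> matchings E" for M
    proof -
      have sub: "\<Union>M \<subseteq> V" using matchings_sub[OF M] E_sub by blast
      have fM: "finite M" using matchings_sub[OF M] finE finite_subset by blast
      have "(\<Prod>v\<in>V. b v (mate M v)) = (\<Prod>v\<in>V. if mate M v = v then x else t {v, mate M v})"
      proof (intro prod.cong refl)
        fix v
        show "b v (mate M v) = (if mate M v = v then x else t {v, mate M v})"
        proof (cases "mate M v = v")
          case False
          then have "v \<in> \<Union>M" using mate_outside by metis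
          then have "{v, mate M v} \<in> M" using mate_in(1)[OF M E_card] by blast
          then have "{v, mate M v} \<in> E" using matchings_sub[OF M] by blast
          then show ?thesis using False by (simp add: b_def)
        qed (simp add: b_def)
      qed
      also have "\<dots> = x ^ (card V - 2 * card M)"
        by (rule prod_mate[OF M finE E_card t finV sub])
      finally show ?thesis using sign_mate[OF M E_card fM] by simp
    qed
    then show ?thesis by (simp add: sum.reindex[OF inj])
  qed
  also have "sum ?f cyclic_perms = ?B"
  proof -
    let ?g = "\<lambda>N. (- 1) ^ (q - 1) * (\<Prod>e\<in>C. t e) * ((- 1) ^ card N * x ^ (card V - q - 2 * card N)) :: 'b"
    have w: "?f (s \<circ> mate N) = ?g N" if s: "s \<in> {rot, unrot}" and N: "N \<in> matchings D" for s N
    proof -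
      have sp: "s permutes W" using s rot_permutes permutes_inv by blast
      have rp: "permutation rot" by (rule permutation_of_cycle)
      have sgs: "sign s = (- 1) ^ (q - 1)"
        using s sign_inverse[OF rp] sign_cycle_of_list[OF xs_distinct] by auto
      have NE: "N \<in> matchings E" using N matchings_mono[OF D_sub] by blast
      have sub: "\<Union>N \<subseteq> V - W" by (rule matching_D_avoids[OF N])
      have fN: "finite N" using matchings_sub[OF N] finD finite_subset by blast
      have mp: "mate N permutes V - W" by (rule mate_permutes[OF NE E_card sub])
      have "permutation s" "permutation (mate N)"
        using sp mp finV by (auto simp: permutation_permutes)
      then have sg: "sign (s \<circ> mate N) = (- 1) ^ (q - 1) * (- 1) ^ card N"
        using sign_mate[OF NE E_card fN] sgs by (simp add: sign_compose)
      have "(\<Prod>v\<in>V. b v ((s \<circ> mate N) v)) =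
          (\<Prod>v\<in>V - W. b v ((s \<circ> mate N) v)) * (\<Prod>v\<in>W. b v ((s \<circ> mate N) v))"
        by (rule prod.subset_diff[OF W_sub finV])
      also have "(\<Prod>v\<in>V - W. b v ((s \<circ> mate N) v)) =
          (\<Prod>v\<in>V - W. if mate N v = v then x else t {v, mate N v})"
      proof (intro prod.cong refl)
        fix v assume v: "v \<in> V - W"
        then have "mate N v \<notin> W" using permutes_in_image[OF mp, of v] by blast
        then have e: "(s \<circ> mate N) v = mate N v" using permutes_not_in[OF sp] by simp
        show "b v ((s \<circ> mate N) v) = (if mate N v = v then x else t {v, mate N v})"
        proof (cases "mate N v = v")
          case False
          then have "v \<in> \<Union>N" using mate_outside by metis
          then have "{v, mate N v} \<in> N" using mate_in(1)[OF NE E_card] by blast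
          then have "{v, mate N v} \<in> E" using matchings_sub[OF NE] by blast
          then show ?thesis using False e by (simp add: b_def)
        qed (use e in \<open>simp add: b_def\<close>)
      qed
      also have "\<dots> = x ^ (card (V - W) - 2 * card N)"
        by (rule prod_mate[OF NE finE E_card t _ sub]) (use finV in auto)
      also have "card (V - W) = card V - q"
        using card_Diff_subset[OF _ W_sub] distinct_card[OF xs_distinct] by simp
      also have "(\<Prod>v\<in>W. b v ((s \<circ> mate N) v)) = (\<Prod>v\<in>W. b v (s v))"
        by (intro prod.cong refl) (simp add: mate_D_W[OF N])
      also have "\<dots> = (\<Prod>v\<in>W. b v (rot v))"
      proof (cases "s = rot")
        case False
        then have s': "s = unrot" using s by auto
        have bsym: "b u v = b v u" for u v by (simp add: b_def insert_commute)
        \<comment> \<open>Shifting the index by \<open>rot\<close> turns each backward step into a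
          forward step read from its other end; \<open>b\<close> is symmetric.\<close>
        have "(\<Prod>v\<in>W. b v (s v)) = (\<Prod>v\<in>W. b (rot v) (s (rot v)))"
          by (rule prod.reindex_bij_betw[OF permutes_imp_bij[OF rot_permutes], symmetric])
        also have "\<dots> = (\<Prod>v\<in>W. b v (rot v))"
          using permutes_inverses(2)[OF rot_permutes] s' bsym by simp
        finally show ?thesis .
      qed simp
      also have "\<dots> = (\<Prod>v\<in>W. t {v, rot v})"
      proof (intro prod.cong refl)
        fix v assume v: "v \<in> W"
        then have "{v, rot v} \<in> C" unfolding C_eq by blast
        then show "b v (rot v) = t {v, rot v}"
          using C_sub rot_rot_neq(2)[OF v] by (auto simp: b_def)
      qed
      also have "\<dots> = (\<Prod>e\<in>C. t e)"
        unfolding C_eq by (simp add: prod.reindex[OF inj_on_C])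
      finally show ?thesis using sg by (simp add: mult_ac)
    qed
    have "sum ?f cyclic_perms = (\<Sum>(s, N)\<in>{rot, unrot} \<times> matchings D. ?f (s \<circ> mate N))"
      unfolding cyclic_perms_def by (subst sum.reindex[OF inj_on_cyclic_perms]) (simp add: case_prod_beta')
    also have "\<dots> = (\<Sum>s\<in>{rot, unrot}. \<Sum>N\<in>matchings D. ?f (s \<circ> mate N))"
      by (simp only: sum.cartesian_product)
    also have "\<dots> = (\<Sum>s\<in>{rot, unrot}. sum ?g (matchings D))"
      by (intro sum.cong refl w)
    also have "\<dots> = 2 * sum ?g (matchings D)"
      using rot_neq_inv by simp
    finally show ?thesis by (simp add: sum_distrib_left mult_ac)
  qed
  finally show ?thesis .
qed

section \<open>Edges leaving the cycle\<close>

text \<open>Together with \<open>C\<close> and \<open>D\<close> this exhausts \<open>E\<close>,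
  because the cycle has no chord.\<close>

definition L :: "'a set set" where "L = {e \<in> E. e \<inter> W \<noteq> {} \<and> \<not> e \<subseteq> W}"

abbreviation "adj F \<equiv> {(u, v). {u, v} \<in> F}"

lemma E_doubleton: "{u, v} \<in> E \<Longrightarrow> u \<noteq> v"
  using E_card[of "{u, v}"] by auto

text \<open>A detour around an edge would close up with it to a cycle through that edge, and the
  only cycle is \<open>C\<close>.\<close>

lemma bridge:
  assumes "{u, v} \<in> E" "{u, v} \<notin> C"
  shows "(v, u) \<notin> (adj E - {(u, v), (v, u)})\<^sup>*"
proof
  assume r: "(v, u) \<in> (adj E - {(u, v), (v, u)})\<^sup>*"
  have uv: "(u, v) \<in> adj E" using assms(1) by simp
  obtain ys where "closed_path (adj E) ys" "{u, v} \<in> closed_path_edges ys"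
    by (rule edge_on_closed_path[OF uv E_doubleton[OF assms(1)] r])
  then show False using unique[of ys] assms(2) by simp
qed

lemma C_connected:
  assumes "a \<in> W" "b \<in> W"
  shows "(a, b) \<in> (adj C)\<^sup>*"
proof -
  have "(rot ^^ n) a \<in> W \<and> (a, (rot ^^ n) a) \<in> (adj C)\<^sup>*" for n
  proof (induction n)
    case (Suc n)
    let ?y = "(rot ^^ n) a"
    have "{?y, rot ?y} \<in> C" using Suc unfolding C_eq by blast
    then have "(?y, rot ?y) \<in> adj C" by simp
    then have "(a, rot ?y) \<in> (adj C)\<^sup>*" using Suc by (meson rtrancl.rtrancl_into_rtrancl)
    then show ?case using Suc rot_in by simp
  qed (use assms in simp)
  moreover obtain n where "b = (rot ^^ n) a" using rot_orbit[OF assms] .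
  ultimately show ?thesis by simp
qed

text \<open>A chord would not be a bridge, as the cycle itself joins its ends.\<close>

lemma no_chord:
  assumes "e \<in> E" "e \<subseteq> W"
  shows "e \<in> C"
proof (rule ccontr)
  assume n: "e \<notin> C"
  obtain u v where e: "e = {u, v}" using E_card[OF assms(1)] by (auto simp: card_2_iff)
  have "adj C \<subseteq> adj E - {(u, v), (v, u)}"
    using C_sub n e by (auto simp: insert_commute)
  moreover have "(v, u) \<in> (adj C)\<^sup>*" using assms(2) e by (intro C_connected) auto
  ultimately have "(v, u) \<in> (adj E - {(u, v), (v, u)})\<^sup>*" using rtrancl_mono by blast
  then show False using bridge[of u v] assms(1) n e by simp
qed

lemma edge_cases: "e \<in> E \<Longrightarrow> e \<in> C \<or> e \<in> D \<or> e \<in> L"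
  using no_chord by (auto simp: D_def L_def)

lemma L_cases:
  assumes "e \<in> L"
  obtains c u where "e = {c, u}" "c \<in> W" "u \<notin> W" "e \<in> E"
proof -
  have E: "e \<in> E" using assms by (simp add: L_def)
  then obtain a b where e: "e = {a, b}" using E_card[of e] by (auto simp: card_2_iff)
  show ?thesis
  proof (cases "a \<in> W")
    case True
    then show ?thesis using that[of a b] assms e E by (auto simp: L_def)
  next
    case False
    then show ?thesis using that[of b a] assms e E by (auto simp: L_def insert_commute)
  qed
qed

lemma CDL_disjoint: "C \<inter> D = {}" "C \<inter> L = {}" "D \<inter> L = {}"
proof -
  have "e \<subseteq> W \<and> e \<inter> W \<noteq> {}" if "e \<in> C" for e
    using that rot_in unfolding C_eq by auto
  then show "C \<inter> D = {}" "C \<inter> L = {}" "D \<inter> L = {}" unfolding D_def L_def by auto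
qed

text \<open>Otherwise a path in \<open>D\<close> from \<open>u1\<close> to \<open>u2\<close>, the
  edge to \<open>c2\<close> and a walk along the cycle to \<open>c1\<close> would bypass the bridge
  \<open>{c1, u1}\<close>.\<close>

lemma L_separated:
  assumes 1: "{c1, u1} \<in> E" "c1 \<in> W" "u1 \<notin> W" and 2: "{c2, u2} \<in> E" "c2 \<in> W" "u2 \<notin> W"
    and ne: "(c1, u1) \<noteq> (c2, u2)"
  shows "(u1, u2) \<notin> (adj D)\<^sup>*"
proof
  assume r: "(u1, u2) \<in> (adj D)\<^sup>*"
  let ?R = "adj E - {(c1, u1), (u1, c1)}"
  have "adj D \<subseteq> ?R" using 1 by (auto simp: D_def)
  then have "(u1, u2) \<in> ?R\<^sup>*" using r rtrancl_mono by blast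
  also have "(u2, c2) \<in> ?R" using 1 2 ne by (auto simp: insert_commute)
  also have "(c2, c1) \<in> ?R\<^sup>*"
  proof -
    have "v \<in> W" if "{u, v} \<in> C" for u v
    proof -
      have "v \<in> \<Union>C" using that by blast
      then show ?thesis unfolding Union_C .
    qed
    then have "{u, u1} \<notin> C" "{u1, u} \<notin> C" for u
      using 1(3) insert_commute[of u u1 "{}"] by metis+
    then have "adj C \<subseteq> ?R" using C_sub by auto
    then show ?thesis using C_connected[OF 2(2) 1(2)] rtrancl_mono by blast
  qed
  finally have "(u1, c1) \<in> ?R\<^sup>*" .
  moreover have "{c1, u1} \<notin> C"
  proof
    assume "{c1, u1} \<in> C"
    then have "u1 \<in> \<Union>C" by blast
    then show False using 1(3) unfolding Union_C by blast
  qed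
  ultimately show False using bridge[OF 1(1)] by blast
qed

text \<open>The neighbours of the cycle; under contraction they give the neighbours of the cyclic
  vertex.\<close>

definition attach :: "'a set" where "attach = \<Union>L - W"

lemma attach_cases:
  assumes "u \<in> attach"
  obtains c where "{c, u} \<in> L" "{c, u} \<in> E" "c \<in> W" "u \<notin> W"
proof -
  obtain e where e: "e \<in> L" "u \<in> e" "u \<notin> W" using assms unfolding attach_def by blast
  obtain c v where "e = {c, v}" "c \<in> W" "v \<notin> W" "e \<in> E" using L_cases[OF e(1)] .
  then show ?thesis using that[of c] e by auto
qed

lemma attach_separated:
  assumes "u \<in> attach" "v \<in> attach" "u \<noteq> v"
  shows "(u, v) \<notin> (adj D)\<^sup>*"
proof -
  obtain c where c: "{c, u} \<in> L" "{c, u} \<in> E" "c \<in> W" "u \<notin> W" using attach_cases[OF assms(1)] .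
  obtain d where d: "{d, v} \<in> L" "{d, v} \<in> E" "d \<in> W" "v \<notin> W" using attach_cases[OF assms(2)] .
  show ?thesis using L_separated[OF c(2-4) d(2-4)] assms(3) by simp
qed

section \<open>Matching numbers and the saturation condition\<close>

definition mD :: nat where "mD = Max (card ` matchings D)"
definition mE :: nat where "mE = Max (card ` matchings E)"

lemma mD_ge: "N \<in> matchings D \<Longrightarrow> card N \<le> mD"
  unfolding mD_def using finite_matchings[OF finD] by (intro Max_ge) auto

lemma mE_ge: "M \<in> matchings E \<Longrightarrow> card M \<le> mE"
  unfolding mE_def using finite_matchings[OF finE] by (intro Max_ge) auto

lemma mD_attained: obtains N where "N \<in> matchings D" "card N = mD"
proof -
  have "mD \<in> card ` matchings D"
    unfolding mD_def using finite_matchings[OF finD] matchings_empty by (intro Max_in) blast+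
  then show ?thesis using that by auto
qed

lemma mE_attained: obtains M where "M \<in> matchings E" "card M = mE"
proof -
  have "mE \<in> card ` matchings E"
    unfolding mE_def using finite_matchings[OF finE] matchings_empty by (intro Max_in) blast+
  then show ?thesis using that by auto
qed

text \<open>The quantifier ranges over all maximum matchings of \<open>D\<close>, because a single
  one that misses an attaching vertex already leaves room for one more edge.\<close>

definition saturated :: bool where
  "saturated \<longleftrightarrow> (\<forall>N\<in>matchings D. card N = mD \<longrightarrow> attach \<subseteq> \<Union>N)"

text \<open>
  Let \<open>K\<close> be the component of \<open>u\<close> in \<open>G - V(C)\<close>. A maximum matching has strictly more edges in \<open>K\<close>
  than \<open>N\<close>, since exchanging the two on \<open>K\<close> would otherwise give a maximum matching that misses \<open>u\<close>.
  So \<open>N\<close> can be enlarged inside \<open>K\<close>, which contains no further attaching vertex.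
\<close>

lemma saturated_avoiding:
  assumes sat: saturated and "finite U" "U \<subseteq> attach" "N \<in> matchings D" "U \<inter> \<Union>N = {}"
  shows "card N + card U \<le> mD"
  using assms(2-5)
proof (induction U arbitrary: N rule: finite_induct)
  case empty
  then show ?case using mD_ge by simp
next
  case (insert u U)
  obtain N' where N': "N' \<in> matchings D" "card N' = mD" using mD_attained .
  define K where "K = {w. (u, w) \<in> (adj D)\<^sup>*}"
  have uK: "u \<in> K" by (simp add: K_def)
  have Kc: "e \<noteq> {} \<and> (e \<subseteq> K \<or> e \<inter> K = {})" if e: "e \<in> D" for e
  proof -
    obtain a b where ab: "e = {a, b}" using E_card[of e] D_sub e by (auto simp: card_2_iff)
    have "(a, b) \<in> adj D" "(b, a) \<in> adj D" using e ab by (auto simp: insert_commute)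
    then have "a \<in> K \<longleftrightarrow> b \<in> K"
      unfolding K_def using rtrancl.rtrancl_into_rtrancl[of u _ "adj D"] by blast
    then show ?thesis using ab by auto
  qed
  note ex = matching_exchange[where K = K, OF _ _ finD Kc]
  let ?A = "{e \<in> N. e \<inter> K = {}}" and ?B = "{e \<in> N. e \<subseteq> K}"
  let ?A' = "{e \<in> N'. e \<inter> K = {}}" and ?B' = "{e \<in> N'. e \<subseteq> K}"
  have split: "M = {e \<in> M. e \<inter> K = {}} \<union> {e \<in> M. e \<subseteq> K}" if "M \<in> matchings D" for M
    using matchings_sub[OF that] Kc by blast
  have cN: "card N = card ?A + card ?B"
    using ex(2)[OF insert.prems(2) insert.prems(2)] split[OF insert.prems(2)] by simp
  have cN': "card N' = card ?A' + card ?B'"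
    using ex(2)[OF N'(1) N'(1)] split[OF N'(1)] by simp
  have "u \<notin> \<Union>(?A' \<union> ?B)" using uK insert.prems(3) by blast
  moreover have "u \<in> attach" using insert.prems(1) by blast
  ultimately have "card (?A' \<union> ?B) \<noteq> mD"
    using sat ex(1)[OF N'(1) insert.prems(2)] unfolding saturated_def by blast
  moreover have "card (?A' \<union> ?B) \<le> mD" by (rule mD_ge[OF ex(1)[OF N'(1) insert.prems(2)]])
  ultimately have "card ?A' + card ?B < mD"
    using ex(2)[OF N'(1) insert.prems(2)] by simp
  then have "card ?B < card ?B'" using cN' N'(2) by simp
  then have c: "card N < card (?A \<union> ?B')"
    using ex(2)[OF insert.prems(2) N'(1)] cN by simp
  have "U \<inter> K = {}"
  proof -
    have "v \<notin> K" if "v \<in> U" for v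
      using attach_separated[of u v] that insert.hyps(2) insert.prems(1) unfolding K_def by auto
    then show ?thesis by blast
  qed
  then have "U \<inter> \<Union>(?A \<union> ?B') = {}" using insert.prems(3) by blast
  moreover have "U \<subseteq> attach" using insert.prems(1) by blast
  ultimately have "card (?A \<union> ?B') + card U \<le> mD"
    using insert.IH ex(1)[OF insert.prems(2) N'(1)] by blast
  then show ?case using c insert.hyps by simp
qed

text \<open>The second bound counts covered cycle vertices, two for an edge of \<open>C\<close> and
  one for an edge of \<open>L\<close>. For the third, the outer ends of \<open>M \<inter> L\<close>
  are attaching vertices missed by \<open>M \<inter> D\<close>, so \<open>saturated_avoiding\<close>
  applies. Together the three give \<open>card M \<le> mD + q div 2\<close> in the saturated
  case.\<close>

lemma matching_parts:
  assumes M: "M \<in> matchings E"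
  shows "card M = card (M \<inter> C) + card (M \<inter> D) + card (M \<inter> L)"
    and "2 * card (M \<inter> C) + card (M \<inter> L) \<le> q"
    and "saturated \<Longrightarrow> card (M \<inter> D) + card (M \<inter> L) \<le> mD"
proof -
  have finM: "finite M" using matchings_sub[OF M] finE finite_subset by blast
  have split: "M = (M \<inter> C) \<union> (M \<inter> D) \<union> (M \<inter> L)"
    using matchings_sub[OF M] edge_cases by blast
  have "card ((M \<inter> C) \<union> (M \<inter> D) \<union> (M \<inter> L)) = card ((M \<inter> C) \<union> (M \<inter> D)) + card (M \<inter> L)"
    using finM CDL_disjoint by (intro card_Un_disjoint) auto
  also have "card ((M \<inter> C) \<union> (M \<inter> D)) = card (M \<inter> C) + card (M \<inter> D)"
    using finM CDL_disjoint by (intro card_Un_disjoint) auto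
  finally show "card M = card (M \<inter> C) + card (M \<inter> D) + card (M \<inter> L)" using split by simp
  have Lpart: "card (e \<inter> W) = 1 \<and> card (e - W) = 1" if eL: "e \<in> L" for e
  proof -
    obtain c u where "e = {c, u}" "c \<in> W" "u \<notin> W" "e \<in> E" using L_cases[OF eL] .
    then have "e \<inter> W = {c}" "e - W = {u}" by auto
    then show ?thesis by simp
  qed
  have dis: "e \<inter> f = {}" if "e \<in> M" "f \<in> M" "e \<noteq> f" for e f
    using matchings_disjoint[OF M] that .
  \<comment> \<open>Used twice: with \<open>g e\<close> the end of \<open>e\<close> on the cycle,
    and with \<open>g e\<close> its end outside.\<close>
  have cardL: "card (\<Union>e\<in>M \<inter> L. g e) = card (M \<inter> L)"
    if g: "\<And>e. e \<in> L \<Longrightarrow> card (g e) = 1" "\<And>e. g e \<subseteq> e" for g :: "'a set \<Rightarrow> 'a set"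
  proof -
    have "card (\<Union>e\<in>M \<inter> L. g e) = (\<Sum>e\<in>M \<inter> L. card (g e))"
    proof (rule card_UN_disjoint)
      show "finite (M \<inter> L)" using finM by simp
      show "\<forall>e\<in>M \<inter> L. finite (g e)" using g(1) by (auto intro: card_ge_0_finite)
      show "\<forall>e\<in>M \<inter> L. \<forall>f\<in>M \<inter> L. e \<noteq> f \<longrightarrow> g e \<inter> g f = {}"
      proof (intro ballI impI)
        fix e f assume "e \<in> M \<inter> L" "f \<in> M \<inter> L" "e \<noteq> f"
        then have "e \<inter> f = {}" using dis by blast
        then show "g e \<inter> g f = {}" using g(2)[of e] g(2)[of f] by blast
      qed
    qed
    then show ?thesis using g(1) by simp
  qed
  have "M \<inter> C \<in> matchings E" using matchings_subset[OF M, of "M \<inter> C" E] C_sub by auto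
  then have "2 * card (M \<inter> C) = card (\<Union>(M \<inter> C))" using card_Union_matching[OF _ finE E_card] by simp
  moreover have "card (M \<inter> L) = card (\<Union>e\<in>M \<inter> L. e \<inter> W)" using cardL[of "\<lambda>e. e \<inter> W"] Lpart by simp
  moreover have "card (\<Union>(M \<inter> C) \<union> (\<Union>e\<in>M \<inter> L. e \<inter> W)) = card (\<Union>(M \<inter> C)) + card (\<Union>e\<in>M \<inter> L. e \<inter> W)"
  proof (rule card_Un_disjoint)
    have "\<Union>(M \<inter> C) \<subseteq> W" using Union_C by blast
    then show "finite (\<Union>(M \<inter> C))" by (rule finite_subset) simp
    show "finite (\<Union>e\<in>M \<inter> L. e \<inter> W)" using finM by simp
    have "e \<inter> f = {}" if "e \<in> M \<inter> C" "f \<in> M \<inter> L" for e f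
      using that CDL_disjoint(2) by (intro dis) auto
    then show "\<Union>(M \<inter> C) \<inter> (\<Union>e\<in>M \<inter> L. e \<inter> W) = {}" by blast
  qed
  moreover have "card (\<Union>(M \<inter> C) \<union> (\<Union>e\<in>M \<inter> L. e \<inter> W)) \<le> card W"
    using Union_C by (intro card_mono) auto
  ultimately show "2 * card (M \<inter> C) + card (M \<inter> L) \<le> q"
    using distinct_card[OF xs_distinct] by simp
  show "card (M \<inter> D) + card (M \<inter> L) \<le> mD" if sat: saturated
  proof -
    have "card (M \<inter> L) = card (\<Union>e\<in>M \<inter> L. e - W)" using cardL[of "\<lambda>e. e - W"] Lpart by simp
    moreover have "card (M \<inter> D) + card (\<Union>e\<in>M \<inter> L. e - W) \<le> mD"
    proof (rule saturated_avoiding[OF sat])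
      have "(\<Union>e\<in>M \<inter> L. e - W) \<subseteq> V" using matchings_sub[OF M] E_sub by blast
      then show "finite (\<Union>e\<in>M \<inter> L. e - W)" using finV finite_subset by blast
      show "(\<Union>e\<in>M \<inter> L. e - W) \<subseteq> attach" unfolding attach_def by blast
      show "M \<inter> D \<in> matchings D" using matchings_subset[OF M, of "M \<inter> D" D] by simp
      have "e \<inter> f = {}" if "e \<in> M \<inter> L" "f \<in> M \<inter> D" for e f
        using that CDL_disjoint(3) by (intro dis) auto
      then show "(\<Union>e\<in>M \<inter> L. e - W) \<inter> \<Union>(M \<inter> D) = {}" by blast
    qed
    ultimately show ?thesis by simp
  qed
qed

section \<open>Counting matchings\<close>

lemma rot_funpow_in: "v \<in> W \<Longrightarrow> (rot ^^ n) v \<in> W"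
  by (induction n) (auto intro: rot_in)

lemma rot_funpow_inj:
  assumes v: "v \<in> W" and ij: "i < q" "j < q" "(rot ^^ i) v = (rot ^^ j) v"
  shows "i = j"
proof -
  obtain a where a: "a < q" "v = xs ! a" using v by (auto simp: in_set_conv_nth)
  have "xs ! ((i + a) mod q) = xs ! ((j + a) mod q)"
    using ij(3) rot_funpow_nth[OF a(1)] a(2) by simp
  moreover have "(i + a) mod q < q" "(j + a) mod q < q" using a(1) by (auto intro!: mod_less_divisor)
  ultimately have "(i + a) mod q = (j + a) mod q"
    using nth_eq_iff_index_eq[OF xs_distinct] by blast
  then show ?thesis using a(1) ij(1,2) by (auto simp: mod_if split: if_splits)
qed

text \<open>Every other edge of the cycle, \<open>h\<close> of them, beginning with
  \<open>{v, rot v}\<close>. For \<open>q = 2 * h\<close> this is a perfect matching of the cycle;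
  for \<open>2 * h < q\<close> the vertex just before \<open>v\<close> stays free.\<close>

definition alternating :: "'a \<Rightarrow> nat \<Rightarrow> 'a set set" where
  "alternating v h = (\<lambda>j. {(rot ^^ (2 * j)) v, (rot ^^ (2 * j + 1)) v}) ` {..<h}"

lemma alternating:
  assumes v: "v \<in> W" and h: "2 * h \<le> q"
  shows "alternating v h \<in> matchings C" "card (alternating v h) = h"
    "\<Union>(alternating v h) = (\<lambda>i. (rot ^^ i) v) ` {..<2 * h}"
proof -
  let ?e = "\<lambda>j. {(rot ^^ (2 * j)) v, (rot ^^ (2 * j + 1)) v}"
  have dis: "?e i \<inter> ?e j = {}" if "i < h" "j < h" "i \<noteq> j" for i j
  proof -
    have "(rot ^^ a) v \<noteq> (rot ^^ b) v" if "a < q" "b < q" "a \<noteq> b" for a b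
      using rot_funpow_inj[OF v that(1,2)] that(3) by blast
    moreover have "2 * i < q" "2 * i + 1 < q" "2 * j < q" "2 * j + 1 < q"
      "2 * i \<noteq> 2 * j" "2 * i + 1 \<noteq> 2 * j" "2 * i \<noteq> 2 * j + 1" "2 * i + 1 \<noteq> 2 * j + 1"
      using that h by presburger+
    ultimately show ?thesis by (simp del: funpow.simps)
  qed
  have "?e j \<in> C" for j
    unfolding C_eq using rot_funpow_in[OF v, of "2 * j"] by (intro image_eqI[of _ _ "(rot ^^ (2 * j)) v"]) auto
  then show "alternating v h \<in> matchings C"
    unfolding alternating_def
  proof (intro matchingsI)
    fix e f assume "e \<in> ?e ` {..<h}" "f \<in> ?e ` {..<h}" "e \<noteq> f"
    then obtain i j where "e = ?e i" "f = ?e j" "i < h" "j < h" "i \<noteq> j" by blast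
    then show "e \<inter> f = {}" using dis[of i j] by blast
  qed auto
  have "inj_on ?e {..<h}"
  proof (rule inj_onI)
    fix i j assume "i \<in> {..<h}" "j \<in> {..<h}" "?e i = ?e j"
    then show "i = j" using dis[of i j] by auto
  qed
  then show "card (alternating v h) = h" unfolding alternating_def by (simp add: card_image)
  show "\<Union>(alternating v h) = (\<lambda>i. (rot ^^ i) v) ` {..<2 * h}" (is "?l = ?r")
  proof (intro equalityI subsetI)
    fix x assume "x \<in> ?l"
    then obtain j where "j < h" "x \<in> ?e j" unfolding alternating_def by blast
    then have "x = (rot ^^ (2 * j)) v \<and> 2 * j < 2 * h \<or> x = (rot ^^ (2 * j + 1)) v \<and> 2 * j + 1 < 2 * h"
      by auto
    then show "x \<in> ?r" by blast
  next
    fix x assume "x \<in> ?r"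
    then obtain i where i: "i < 2 * h" "x = (rot ^^ i) v" by blast
    have "i = 2 * (i div 2) \<or> i = 2 * (i div 2) + 1" by presburger
    then have "x \<in> ?e (i div 2)" using i(2) by (metis insertI1 insertI2)
    moreover have "i div 2 < h" using i(1) by presburger
    ultimately show "x \<in> ?l" unfolding alternating_def by blast
  qed
qed

text \<open>Starting right after \<open>c\<close>, the \<open>2 * h\<close> positions end before the
  rotation comes back to \<open>c\<close>. This frees \<open>c\<close> for an edge that leaves the
  cycle.\<close>

lemma alternating_avoids:
  assumes c: "c \<in> W" and h: "2 * h < q"
  shows "c \<notin> \<Union>(alternating (rot c) h)"
proof
  have rc: "rot c \<in> W" using c rot_in by blast
  assume "c \<in> \<Union>(alternating (rot c) h)"
  then obtain i where i: "i < 2 * h" "c = (rot ^^ i) (rot c)"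
    using alternating(3)[OF rc, of h] h by auto
  have "(rot ^^ Suc i) c = (rot ^^ 0) c" using i(2) by (simp add: funpow_swap1)
  then have "Suc i = 0" using i(1) h by (intro rot_funpow_inj[OF c]) auto
  then show False by simp
qed

lemma Union_matchings_C: "M \<in> matchings C \<Longrightarrow> \<Union>M \<subseteq> W"
  using matchings_sub[of M C] Union_C by blast

lemma matchings_C_E: "M \<in> matchings C \<Longrightarrow> M \<in> matchings E"
  using matchings_mono[OF C_sub] by blast

lemma matchings_D_E: "M \<in> matchings D \<Longrightarrow> M \<in> matchings E"
  using matchings_mono[OF D_sub] by blast

lemma matchings_C_D_Un:
  assumes "P \<in> matchings C" "N \<in> matchings D"
  shows "P \<union> N \<in> matchings E" "card (P \<union> N) = card P + card N"
    "(P \<union> N) \<inter> C = P" "(P \<union> N) \<inter> D = N" "(P \<union> N) \<inter> L = {}"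
proof -
  have "\<Union>P \<inter> \<Union>N = {}" using Union_matchings_C[OF assms(1)] matching_D_avoids[OF assms(2)] by blast
  then show "P \<union> N \<in> matchings E"
    using matchings_C_E[OF assms(1)] matchings_D_E[OF assms(2)] matchings_Un by blast
  have s: "P \<subseteq> C" "N \<subseteq> D" using assms[THEN matchings_sub] by auto
  show "(P \<union> N) \<inter> C = P" "(P \<union> N) \<inter> D = N" "(P \<union> N) \<inter> L = {}"
    using s CDL_disjoint by auto
  have "finite P" "finite N" using s finE C_sub D_sub by (meson finite_subset)+
  then show "card (P \<union> N) = card P + card N" using s CDL_disjoint by (intro card_Un_disjoint) auto
qed

section \<open>Perfect matchings of an even cycle\<close>

text \<open>The vertex \<open>rot w\<close> lies on just these two cycle edges, and a perfect
  matching contains exactly one of them.\<close>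

lemma matching_forward_alternates:
  assumes M: "M \<in> matchings C" "\<Union>M = W" and w: "w \<in> W"
  shows "{rot w, rot (rot w)} \<in> M \<longleftrightarrow> {w, rot w} \<notin> M"
proof
  assume 1: "{rot w, rot (rot w)} \<in> M"
  show "{w, rot w} \<notin> M"
  proof
    assume "{w, rot w} \<in> M"
    then have "{w, rot w} = {rot w, rot (rot w)}" using matchings_disjoint[OF M(1) _ 1] by blast
    then show False using rot_rot_neq(1)[OF w] rot_rot_neq(2)[OF w] by (auto simp: doubleton_eq_iff)
  qed
next
  assume n: "{w, rot w} \<notin> M"
  have "rot w \<in> \<Union>M" using M(2) rot_in[OF w] by simp
  then obtain e where e: "e \<in> M" "rot w \<in> e" by blast
  then have "e \<in> C" using matchings_sub[OF M(1)] by blast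
  then obtain u where u: "u \<in> W" "e = {u, rot u}" unfolding C_eq by blast
  have "rot w = u \<or> rot w = rot u" using e(2) u(2) by blast
  then have "rot w = u \<or> w = u" using permutes_inj[OF rot_permutes] by (auto dest: injD)
  then show "{rot w, rot (rot w)} \<in> M" using n e(1) u(2) by auto
qed

text \<open>Having \<open>h\<close> edges forces \<open>M\<close> to cover the whole cycle.
  Alternation then spreads the decision whether \<open>{v, rot v}\<close> belongs to
  \<open>M\<close> to all other edges.\<close>

lemma perfect_matchings_C:
  assumes q: "q = 2 * h" and M: "M \<in> matchings C" "card M = h" and v: "v \<in> W"
  shows "M = alternating v h \<or> M = alternating (rot v) h"
proof -
  have "card (\<Union>M) = 2 * h"
    using card_Union_matching[OF matchings_C_E[OF M(1)] finE E_card] M(2) by simp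
  then have U: "\<Union>M = W"
    using Union_matchings_C[OF M(1)] distinct_card[OF xs_distinct] q by (intro card_subset_eq) auto
  have fin: "finite M" using matchings_sub[OF M(1)] C_sub finE by (meson finite_subset)
  note alt = matching_forward_alternates[OF M(1) U]
  have *: "M = alternating w h" if w: "w \<in> W" "{w, rot w} \<in> M" for w
  proof -
    have "{(rot ^^ (2 * j)) w, (rot ^^ (2 * j + 1)) w} \<in> M" for j
    proof (induction j)
      case (Suc j)
      let ?y = "(rot ^^ (2 * j)) w"
      have y: "?y \<in> W" using rot_funpow_in[OF w(1)] .
      have "{?y, rot ?y} \<in> M" using Suc by simp
      then have "{rot (rot ?y), rot (rot (rot ?y))} \<in> M"
        using alt[OF y] alt[OF rot_in[OF y]] by simp
      then show ?case by simp
    qed (use w in simp)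
    then have "alternating w h \<subseteq> M" unfolding alternating_def by blast
    moreover have "card (alternating w h) = card M" using alternating(2)[OF w(1)] q M(2) by simp
    ultimately show ?thesis using fin card_subset_eq by metis
  qed
  show ?thesis
  proof (cases "{v, rot v} \<in> M")
    case True
    then show ?thesis using *[OF v] by blast
  next
    case False
    then have "{rot v, rot (rot v)} \<in> M" using alt[OF v] by simp
    then show ?thesis using *[OF rot_in[OF v]] by blast
  qed
qed

lemma alternating_neq:
  assumes "v \<in> W" "0 < h" "2 * h \<le> q"
  shows "alternating v h \<noteq> alternating (rot v) h"
proof
  assume eq: "alternating v h = alternating (rot v) h"
  have "{w, rot w} \<in> alternating w h" for w
    unfolding alternating_def using assms(2) by (intro image_eqI[of _ _ 0]) auto
  then have m: "{v, rot v} \<in> alternating v h" "{rot v, rot (rot v)} \<in> alternating v h"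
    using eq by auto
  have "{v, rot v} = {rot v, rot (rot v)}"
    using matchings_disjoint[OF alternating(1)[OF assms(1,3)] m] by blast
  then show False using rot_rot_neq(1)[OF assms(1)] rot_rot_neq(2)[OF assms(1)] by (auto simp: doubleton_eq_iff)
qed

section \<open>Counting matchings of a given size\<close>

definition nE :: "nat \<Rightarrow> nat" where "nE k = card {M \<in> matchings E. card M = k}"
definition nD :: "nat \<Rightarrow> nat" where "nD k = card {N \<in> matchings D. card N = k}"

abbreviation "x0 \<equiv> xs ! 0"

lemma x0: "x0 \<in> W" using q_ge by (intro nth_mem) auto

text \<open>The matchings of G that offset the rotations: the two perfect matchings of the cycle
  correspond to the two directions, so their number \<open>2 * nD j\<close> equals the weight of the
  cyclic terms with \<open>j\<close> further edges.\<close>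

definition perfect_unions :: "nat \<Rightarrow> nat \<Rightarrow> 'a set set set" where
  "perfect_unions h j = (\<lambda>(P, N). P \<union> N) `
     ({alternating x0 h, alternating (rot x0) h} \<times> {N \<in> matchings D. card N = j})"

lemma perfect_unions:
  assumes q: "q = 2 * h"
  shows "perfect_unions h j = {M \<in> matchings E. card (M \<inter> C) = h \<and> card (M \<inter> D) = j \<and> M \<inter> L = {}}"
    and "card (perfect_unions h j) = 2 * nD j"
proof -
  have h: "0 < h" "2 * h \<le> q" using q q_ge by auto
  let ?A = "{alternating x0 h, alternating (rot x0) h}"
  have A: "P \<in> matchings C \<and> card P = h" if "P \<in> ?A" for P
    using that alternating(1,2)[OF x0 h(2)] alternating(1,2)[OF rot_in[OF x0] h(2)] by blast
  show "perfect_unions h j = {M \<in> matchings E. card (M \<inter> C) = h \<and> card (M \<inter> D) = j \<and> M \<inter> L = {}}"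
    (is "_ = ?R")
  proof (intro equalityI subsetI)
    fix M assume "M \<in> perfect_unions h j"
    then obtain P N where PN: "P \<in> ?A" "N \<in> matchings D" "card N = j" "M = P \<union> N"
      unfolding perfect_unions_def by auto
    then show "M \<in> ?R" using matchings_C_D_Un[of P N] A[OF PN(1)] by simp
  next
    fix M assume M: "M \<in> ?R"
    have "M \<inter> C \<in> matchings C" "M \<inter> D \<in> matchings D"
      using M matchings_subset[of M E "M \<inter> C" C] matchings_subset[of M E "M \<inter> D" D] by auto
    moreover have "M \<inter> C \<in> ?A" using perfect_matchings_C[OF q _ _ x0] calculation(1) M by blast
    moreover have "M = (M \<inter> C) \<union> (M \<inter> D)"
    proof -
      have "M \<subseteq> E" using M matchings_sub by blast
      then show ?thesis using M edge_cases by blast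
    qed
    ultimately show "M \<in> perfect_unions h j"
      unfolding perfect_unions_def using M
      by (intro image_eqI[of _ _ "(M \<inter> C, M \<inter> D)"]) auto
  qed
  have "inj_on (\<lambda>(P, N). P \<union> N) (?A \<times> {N \<in> matchings D. card N = j})"
  proof (rule inj_onI)
    fix a b assume a: "a \<in> ?A \<times> {N \<in> matchings D. card N = j}" and b: "b \<in> ?A \<times> {N \<in> matchings D. card N = j}"
      and eq: "(case a of (P, N) \<Rightarrow> P \<union> N) = (case b of (P, N) \<Rightarrow> P \<union> N)"
    obtain P N P' N' where ab: "a = (P, N)" "b = (P', N')" by (cases a, cases b)
    have m: "P \<in> matchings C" "N \<in> matchings D" "P' \<in> matchings C" "N' \<in> matchings D"
      using a b ab A by blast+
    have "P \<union> N = P' \<union> N'" using eq ab by simp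
    then show "a = b"
      using ab matchings_C_D_Un(3,4)[OF m(1,2)] matchings_C_D_Un(3,4)[OF m(3,4)] by simp
  qed
  then show "card (perfect_unions h j) = 2 * nD j"
    unfolding perfect_unions_def nD_def
    using alternating_neq[OF x0 h] by (simp add: card_image card_cartesian_product)
qed

lemma perfect_unions_sub:
  assumes "q = 2 * h"
  shows "perfect_unions h j \<subseteq> {M \<in> matchings E. card M = h + j}"
  using perfect_unions(1)[OF assms] matching_parts(1) by auto

text \<open>The perfect unions already number \<open>2 * nD j\<close>, so a single matching of the
  same size outside this family makes the inequality strict.\<close>

lemma nE_gt:
  assumes "q = 2 * h" "M \<in> matchings E" "card M = h + j" "card (M \<inter> C) \<noteq> h \<or> M \<inter> L \<noteq> {}"
  shows "2 * nD j < nE (h + j)"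
proof -
  have "M \<notin> perfect_unions h j" using perfect_unions(1)[OF assms(1)] assms(4) by auto
  then have "perfect_unions h j \<subset> {M \<in> matchings E. card M = h + j}"
    using perfect_unions_sub[OF assms(1)] assms(2,3) by blast
  then show ?thesis
    unfolding nE_def perfect_unions(2)[OF assms(1), symmetric]
    using finite_matchings[OF finE] by (intro psubset_card_mono) auto
qed

lemma nE_pos: "k \<le> mE \<Longrightarrow> 0 < nE k"
proof -
  assume k: "k \<le> mE"
  obtain M where M: "M \<in> matchings E" "card M = mE" using mE_attained .
  obtain N where N: "N \<subseteq> M" "card N = k" using obtain_subset_with_card_n[of k M] k M(2) by auto
  have "N \<in> matchings E" using matchings_subset[OF M(1) N(1)] N(1) matchings_sub[OF M(1)] by blast
  then have "{M \<in> matchings E. card M = k} \<noteq> {}" using N(2) by blast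
  then show ?thesis unfolding nE_def using finite_matchings[OF finE] by (simp add: card_gt_0_iff)
qed

lemma nD_pos: "0 < nD mD"
proof -
  obtain N where "N \<in> matchings D" "card N = mD" using mD_attained .
  then have "{N \<in> matchings D. card N = mD} \<noteq> {}" by blast
  then show ?thesis unfolding nD_def using finite_matchings[OF finD] by (simp add: card_gt_0_iff)
qed

lemma mE_ge_half: "2 * h \<le> q \<Longrightarrow> mD + h \<le> mE"
proof -
  assume h: "2 * h \<le> q"
  obtain N where N: "N \<in> matchings D" "card N = mD" using mD_attained .
  show ?thesis
    using mE_ge[OF matchings_C_D_Un(1)[OF alternating(1)[OF x0 h] N(1)]]
      matchings_C_D_Un(2)[OF alternating(1)[OF x0 h] N(1)] alternating(2)[OF x0 h] N(2) by simp
qed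

lemma mE_saturated:
  assumes saturated
  shows "mE = mD + q div 2"
proof -
  obtain M where M: "M \<in> matchings E" "card M = mE" using mE_attained .
  have "mE \<le> mD + q div 2"
    using matching_parts[OF M(1)] assms M(2) by linarith
  then show ?thesis using mE_ge_half[of "q div 2"] by simp
qed

text \<open>Take a maximum matching of \<open>D\<close> that misses an attaching vertex
  \<open>u\<close>, and a neighbour \<open>c\<close> of \<open>u\<close> on the cycle. Choosing
  \<open>h\<close> alternating edges that avoid \<open>c\<close> leaves both ends of
  \<open>{c, u}\<close> free.\<close>

lemma unsaturated_matching:
  assumes "\<not> saturated" "2 * h < q"
  obtains M where "M \<in> matchings E" "card M = mD + h + 1" "M \<inter> L \<noteq> {}"
proof -
  obtain N u where N: "N \<in> matchings D" "card N = mD" "u \<in> attach" "u \<notin> \<Union>N"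
    using assms(1) unfolding saturated_def by blast
  obtain c where c: "{c, u} \<in> L" "{c, u} \<in> E" "c \<in> W" "u \<notin> W" using attach_cases[OF N(3)] .
  let ?P = "alternating (rot c) h"
  have P: "?P \<in> matchings C" "card ?P = h"
    using alternating(1,2)[OF rot_in[OF c(3)]] assms(2) by auto
  have PN: "?P \<union> N \<in> matchings E" "card (?P \<union> N) = mD + h" "(?P \<union> N) \<inter> L = {}"
    using matchings_C_D_Un[OF P(1) N(1)] P(2) N(2) by auto
  have nin: "{c, u} \<notin> ?P \<union> N" using PN(3) c(1) by blast
  have "c \<notin> \<Union>?P" by (rule alternating_avoids[OF c(3) assms(2)])
  moreover have "c \<notin> \<Union>N" using matching_D_avoids[OF N(1)] c(3) by blast
  moreover have "u \<notin> \<Union>?P" using Union_matchings_C[OF P(1)] c(4) by blast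
  ultimately have "{c, u} \<inter> \<Union>(?P \<union> N) = {}" using N(4) by blast
  then have M: "insert {c, u} (?P \<union> N) \<in> matchings E"
    using matchings_insert_iff[OF nin] PN(1) c(2) by blast
  have "finite (?P \<union> N)" using matchings_sub[OF PN(1)] finE finite_subset by blast
  then have "card (insert {c, u} (?P \<union> N)) = mD + h + 1" using nin PN(2) by simp
  moreover have "insert {c, u} (?P \<union> N) \<inter> L \<noteq> {}" using c(1) by blast
  ultimately show ?thesis using that[OF M] by blast
qed

text \<open>A matching of this size attains the bounds of \<open>matching_parts\<close>: it must
  have \<open>h\<close> edges on the cycle, hence none leaving it, and \<open>mD\<close> edges in
  \<open>D\<close>.\<close>

lemma nE_saturated:
  assumes saturated and q: "q = 2 * h"
  shows "nE (h + mD) = 2 * nD mD"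
proof -
  have "{M \<in> matchings E. card M = h + mD} \<subseteq> perfect_unions h mD"
  proof
    fix M assume M: "M \<in> {M \<in> matchings E. card M = h + mD}"
    then have ME: "M \<in> matchings E" by simp
    have "card (M \<inter> C) = h \<and> card (M \<inter> D) = mD \<and> card (M \<inter> L) = 0"
      using matching_parts[OF ME] assms M by simp
    moreover have "finite (M \<inter> L)" using matchings_sub[OF ME] finE by (meson finite_Int finite_subset)
    ultimately show "M \<in> perfect_unions h mD" unfolding perfect_unions(1)[OF q] using ME by simp
  qed
  then have "{M \<in> matchings E. card M = h + mD} = perfect_unions h mD"
    using perfect_unions_sub[OF q] by blast
  then show ?thesis unfolding nE_def using perfect_unions(2)[OF q] by simp
qed

text \<open>One edge is given up on the cycle rather than outside it: \<open>h - 1\<close> cycle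
  edges and a maximum matching of \<open>D\<close> have the right size but do not form a perfect
  union.\<close>

lemma nE_next:
  assumes q: "q = 2 * h" and "0 < mD"
  shows "2 * nD (mD - 1) < nE (h + (mD - 1))"
proof -
  obtain N where N: "N \<in> matchings D" "card N = mD" using mD_attained .
  have h: "2 * (h - 1) \<le> q" "0 < h" using q q_ge by auto
  let ?P = "alternating x0 (h - 1)"
  have P: "?P \<in> matchings C" "card ?P = h - 1" using alternating(1,2)[OF x0 h(1)] by auto
  show ?thesis
    using matchings_C_D_Un[OF P(1) N(1)] P(2) N(2) h(2) assms(2)
    by (intro nE_gt[OF q, of "?P \<union> N"]) auto
qed

text \<open>Here \<open>h - 1\<close> cycle edges, a maximum matching of \<open>D\<close> and an
  edge leaving the cycle give the extra matching.\<close>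

lemma nE_unsaturated:
  assumes "\<not> saturated" and q: "q = 2 * h"
  shows "2 * nD mD < nE (h + mD)"
proof -
  have h: "2 * (h - 1) < q" "0 < h" using q q_ge by auto
  obtain M where "M \<in> matchings E" "card M = mD + (h - 1) + 1" "M \<inter> L \<noteq> {}"
    using unsaturated_matching[OF assms(1) h(1)] .
  then show ?thesis using h(2) by (intro nE_gt[OF q, of M]) auto
qed

section \<open>Order of the characteristic polynomial at zero\<close>

abbreviation "n \<equiv> card V"

text \<open>The negative sign of the cycle is built into the weight 2; a positive cycle would give
  -2.\<close>

definition matching_expansion :: "real poly" where
  "matching_expansion =
     (\<Sum>M\<in>matchings E. (- 1) ^ card M * [:0, 1:] ^ (n - 2 * card M)) +
     2 * (\<Sum>N\<in>matchings D. (- 1) ^ card N * [:0, 1:] ^ (n - q - 2 * card N))"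

text \<open>\<open>coE\<close> and \<open>coD\<close> are indexed by codegree, the number of
  vertices covered by the matching and, in \<open>coD\<close>, the cycle. The lowest surviving
  exponent then belongs to the largest \<open>d\<close>.\<close>

definition coE :: "nat \<Rightarrow> real" where
  "coE d = (\<Sum>M\<in>matchings E. if 2 * card M = d then (- 1) ^ card M else 0)"

definition coD :: "nat \<Rightarrow> real" where
  "coD d = (\<Sum>N\<in>matchings D. if q + 2 * card N = d then (- 1) ^ card N else 0)"

text \<open>This bound and the next make the truncated subtractions in the exponents exact.\<close>

lemma matching_size: "M \<in> matchings E \<Longrightarrow> 2 * card M \<le> n"
proof -
  assume M: "M \<in> matchings E"
  have "\<Union>M \<subseteq> V" using matchings_sub[OF M] E_sub by blast
  then have "card (\<Union>M) \<le> n" by (rule card_mono[OF finV])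
  then show ?thesis using card_Union_matching[OF M finE E_card] by simp
qed

lemma matching_size_D: "N \<in> matchings D \<Longrightarrow> q + 2 * card N \<le> n"
proof -
  assume N: "N \<in> matchings D"
  have "card (\<Union>N) \<le> card (V - W)" using matching_D_avoids[OF N] finV by (intro card_mono) auto
  also have "\<dots> = n - q" using card_Diff_subset[OF _ W_sub] distinct_card[OF xs_distinct] by simp
  finally have "2 * card N \<le> n - q"
    using card_Union_matching[OF matchings_D_E[OF N] finE E_card] by simp
  moreover have "q \<le> n" using card_mono[OF finV W_sub] distinct_card[OF xs_distinct] by simp
  ultimately show ?thesis by simp
qed

lemma coeff_matching_expansion:
  assumes "d \<le> n"
  shows "coeff matching_expansion (n - d) = coE d + 2 * coD d"
proof -
  have X: "coeff ([:0, 1:] ^ k :: real poly) i = (if i = k then 1 else 0)" for k i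
    by (simp add: monom_altdef[of 1, simplified, symmetric])
  have "(\<Sum>M\<in>matchings E. coeff ((- 1) ^ card M * [:0, 1:] ^ (n - 2 * card M)) (n - d)) = coE d"
    unfolding coE_def coeff_minus_one_power_mult X
  proof (intro sum.cong refl)
    fix M assume "M \<in> matchings E"
    then have "n - d = n - 2 * card M \<longleftrightarrow> 2 * card M = d" using matching_size assms by fastforce
    then show "(- 1) ^ card M * (if n - d = n - 2 * card M then 1 else 0) =
        (if 2 * card M = d then (- 1) ^ card M else (0 :: real))" by simp
  qed
  moreover have "(\<Sum>N\<in>matchings D. coeff ((- 1) ^ card N * [:0, 1:] ^ (n - q - 2 * card N)) (n - d)) = coD d"
    unfolding coD_def coeff_minus_one_power_mult X
  proof (intro sum.cong refl)
    fix N assume "N \<in> matchings D"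
    then have "n - d = n - q - 2 * card N \<longleftrightarrow> q + 2 * card N = d" using matching_size_D assms by fastforce
    then show "(- 1) ^ card N * (if n - d = n - q - 2 * card N then 1 else 0) =
        (if q + 2 * card N = d then (- 1) ^ card N else (0 :: real))" by simp
  qed
  moreover have "coeff (2 * r) i = 2 * coeff r i" for r :: "real poly" and i
    by (simp add: numeral_poly)
  ultimately show ?thesis
    unfolding matching_expansion_def by (simp add: coeff_sum)
qed

lemma coE_even: "coE (2 * k) = (- 1) ^ k * real (nE k)"
proof -
  have "coE (2 * k) = (\<Sum>M\<in>{M \<in> matchings E. card M = k}. (- 1) ^ card M)"
    unfolding coE_def sum.inter_filter[OF finite_matchings[OF finE]] by (intro sum.cong) auto
  then show ?thesis by (simp add: nE_def)
qed

lemma coD_even: "coD (q + 2 * k) = (- 1) ^ k * real (nD k)"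
proof -
  have "coD (q + 2 * k) = (\<Sum>M\<in>{M \<in> matchings D. card M = k}. (- 1) ^ card M)"
    unfolding coD_def sum.inter_filter[OF finite_matchings[OF finD]] by (intro sum.cong) auto
  then show ?thesis by (simp add: nD_def)
qed

lemma coE_0: "odd d \<or> 2 * mE < d \<Longrightarrow> coE d = 0"
  unfolding coE_def using mE_ge by (intro sum.neutral) fastforce

lemma coD_0: "odd (q + d) \<or> d < q \<or> q + 2 * mD < d \<Longrightarrow> coD d = 0"
  unfolding coD_def using mD_ge by (intro sum.neutral) fastforce

lemma order_matching_expansion:
  assumes "d \<le> n" "coE d + 2 * coD d \<noteq> 0" "\<And>e. d < e \<Longrightarrow> coE e + 2 * coD e = 0"
  shows "Polynomial.order 0 matching_expansion = n - d"
proof (rule order_0_eqI)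
  show "coeff matching_expansion (n - d) \<noteq> 0" using assms(1,2) coeff_matching_expansion by simp
  fix i assume "i < n - d"
  then have "d < n - i" "n - (n - i) = i" by auto
  then show "coeff matching_expansion i = 0"
    using coeff_matching_expansion[of "n - i"] assms(3)[of "n - i"] by simp
qed

section \<open>The order according to the cycle length and saturation\<close>

text \<open>The codegrees of the two sums have opposite parities, so nothing cancels. Saturation
  gives \<open>q + 2 * mD = 2 * mE + 1\<close>, and the cyclic sum reaches exactly one exponent
  lower.\<close>

lemma order_odd_saturated:
  assumes "odd q" saturated
  shows "int (Polynomial.order 0 matching_expansion) = int n - 2 * int mE - 1"
proof -
  have d: "q + 2 * mD = 2 * mE + 1" using mE_saturated[OF assms(2)] assms(1) by presburger
  have le: "q + 2 * mD \<le> n" using mD_attained matching_size_D by metis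
  have "Polynomial.order 0 matching_expansion = n - (q + 2 * mD)"
  proof (rule order_matching_expansion[OF le])
    show "coE (q + 2 * mD) + 2 * coD (q + 2 * mD) \<noteq> 0"
      using coE_0[of "q + 2 * mD"] d nD_pos unfolding coD_even by simp
    fix e assume "q + 2 * mD < e"
    then show "coE e + 2 * coD e = 0" using coE_0[of e] coD_0[of e] d by simp
  qed
  then show ?thesis using d le by simp
qed

text \<open>An edge leaving the cycle covers the vertex that \<open>h\<close> cycle edges leave
  free, so \<open>2 * mE\<close> exceeds \<open>q + 2 * mD\<close> and the matching sum reaches
  lower.\<close>

lemma order_odd_unsaturated:
  assumes "odd q" "\<not> saturated"
  shows "int (Polynomial.order 0 matching_expansion) = int n - 2 * int mE"
proof -
  obtain h where q: "q = 2 * h + 1" using assms(1) oddE by blast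
  obtain M where "M \<in> matchings E" "card M = mD + h + 1"
    using unsaturated_matching[OF assms(2), of h] q by auto
  then have big: "q + 2 * mD < 2 * mE" using mE_ge[of M] q by simp
  have le: "2 * mE \<le> n" using mE_attained matching_size by metis
  have "Polynomial.order 0 matching_expansion = n - 2 * mE"
  proof (rule order_matching_expansion[OF le])
    show "coE (2 * mE) + 2 * coD (2 * mE) \<noteq> 0"
      using coD_0[of "2 * mE"] assms(1) nE_pos[of mE] by (simp add: coE_even)
    fix e assume "2 * mE < e"
    then show "coE e + 2 * coD e = 0" using coE_0[of e] coD_0[of e] big by simp
  qed
  then show ?thesis using le by simp
qed

text \<open>Both sums meet in this codegree, with relative sign \<open>(- 1) ^ h\<close>. Hence they
  can cancel only if \<open>h\<close> is odd.\<close>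

lemma coefficient_even:
  assumes q: "q = 2 * h" and "h \<le> k"
  shows "coE (2 * k) + 2 * coD (2 * k) = (- 1) ^ k * (real (nE k) + 2 * (- 1) ^ h * real (nD (k - h)))"
proof -
  have e: "q + 2 * (k - h) = 2 * k" using q assms(2) by simp
  have "(- 1) ^ (k - h) = (- 1) ^ k * ((- 1) ^ h :: real)"
    using assms(2) by (cases "even k"; cases "even h") auto
  then show ?thesis
    using coD_even[of "k - h"] unfolding e coE_even by (simp add: algebra_simps)
qed

text \<open>As \<open>mD + h \<le> mE\<close>, neither sum goes beyond codegree
  \<open>2 * mE\<close>, so this single coefficient decides.\<close>

lemma order_even_eq:
  assumes q: "q = 2 * h" and nz: "real (nE mE) + 2 * (- 1) ^ h * real (nD (mE - h)) \<noteq> 0"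
  shows "int (Polynomial.order 0 matching_expansion) = int n - 2 * int mE"
proof -
  have hm: "mD + h \<le> mE" using mE_ge_half[of h] q by simp
  have le: "2 * mE \<le> n" using mE_attained matching_size by metis
  have "Polynomial.order 0 matching_expansion = n - 2 * mE"
  proof (rule order_matching_expansion[OF le])
    show "coE (2 * mE) + 2 * coD (2 * mE) \<noteq> 0"
      using coefficient_even[OF q, of mE] hm nz by simp
    fix e assume "2 * mE < e"
    then show "coE e + 2 * coD e = 0" using coE_0[of e] coD_0[of e] hm q by simp
  qed
  then show ?thesis using le by simp
qed

lemma order_0_mod_4:
  assumes "q = 2 * h" "even h"
  shows "int (Polynomial.order 0 matching_expansion) = int n - 2 * int mE"
proof (rule order_even_eq[OF assms(1)])
  have "0 < real (nE mE)" using nE_pos[of mE] by simp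
  then show "real (nE mE) + 2 * (- 1) ^ h * real (nD (mE - h)) \<noteq> 0"
    using assms(2) by (simp add: add_pos_nonneg[THEN less_imp_neq, symmetric])
qed

lemma order_2_mod_4_unsaturated:
  assumes q: "q = 2 * h" "odd h" and "\<not> saturated"
  shows "int (Polynomial.order 0 matching_expansion) = int n - 2 * int mE"
proof (rule order_even_eq[OF q(1)])
  have hm: "mD + h \<le> mE" using mE_ge_half[of h] q by simp
  have "2 * nD (mE - h) < nE mE"
  proof (cases "mE = mD + h")
    case True
    then show ?thesis using nE_unsaturated[OF assms(3) q(1)] by (simp add: add.commute)
  next
    case False
    \<comment> \<open>Here \<open>mE - h\<close> exceeds \<open>mD\<close>, so the cyclic sum does
      not reach this codegree.\<close>
    then have "{N \<in> matchings D. card N = mE - h} = {}" using hm mD_ge by fastforce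
    then have "nD (mE - h) = 0" unfolding nD_def by (simp only: card.empty)
    then show ?thesis using nE_pos[of mE] by simp
  qed
  then show "real (nE mE) + 2 * (- 1) ^ h * real (nD (mE - h)) \<noteq> 0" using q(2) by simp
qed

text \<open>The coefficient at codegree \<open>2 * mE\<close> vanishes by
  \<open>nE_saturated\<close> and odd codegrees do not occur, so the next candidate lies two
  exponents higher; there \<open>nE_next\<close> prevents cancellation.\<close>

lemma order_2_mod_4_saturated:
  assumes q: "q = 2 * h" "odd h" and saturated
  shows "int (Polynomial.order 0 matching_expansion) = int n - 2 * int mE + 2"
proof -
  have m: "mE = mD + h" using mE_saturated[OF assms(3)] q by simp
  have h: "2 \<le> h" using q q_ge by simp
  have le: "2 * mE \<le> n" using mE_attained matching_size by metis
  have "Polynomial.order 0 matching_expansion = n - 2 * (mE - 1)"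
  proof (rule order_matching_expansion)
    show "2 * (mE - 1) \<le> n" using le by simp
    show "coE (2 * (mE - 1)) + 2 * coD (2 * (mE - 1)) \<noteq> 0"
    proof (cases "0 < mD")
      case True
      have e: "mE - 1 = h + (mD - 1)" "h \<le> mE - 1" "mE - 1 - h = mD - 1" using True m by auto
      have "2 * nD (mD - 1) < nE (mE - 1)" using nE_next[OF q(1) True] e(1) by simp
      then show ?thesis using coefficient_even[OF q(1) e(2)] q(2) e(3) by simp
    next
      \<comment> \<open>With \<open>mD = 0\<close> the cyclic sum lives only in codegree
        \<open>q = 2 * mE\<close>, so nothing can cancel below it.\<close>
      case False
      then have "2 * (mE - 1) < q" using m q h by simp
      then show ?thesis using coD_0[of "2 * (mE - 1)"] nE_pos[of "mE - 1"] by (simp add: coE_even)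
    qed
    fix e assume e: "2 * (mE - 1) < e"
    show "coE e + 2 * coD e = 0"
    proof (cases "e = 2 * mE")
      case True
      have "nE mE = 2 * nD mD" using nE_saturated[OF assms(3) q(1)] m by (simp add: add.commute)
      then show ?thesis using coefficient_even[OF q(1), of mE] q(2) m True by simp
    next
      case False
      then have "odd e \<or> 2 * mE < e" using e by presburger
      then show ?thesis using coE_0[of e] coD_0[of e] m q by auto
    qed
  qed
  then show ?thesis using le m h by simp
qed

section \<open>Contraction of the cycle\<close>

abbreviation "sing \<equiv> (\<lambda>v :: 'a. {v})"

text \<open>\<open>TD\<close> and \<open>TE\<close> are the edge sets of [T_G] and T_G in the
  encoding of \<open>contract_cycles\<close>: a vertex off the cycle becomes a singleton, and the
  cyclic vertex is \<open>W\<close>.\<close>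

definition TD :: "'a set set set" where "TD = (`) sing ` D"
definition TE :: "'a set set set" where "TE = TD \<union> (\<lambda>u. {W, {u}}) ` attach"

lemma inj_sing: "inj sing" by (simp add: inj_on_def)

lemma matchings_TD: "matchings TD = (`) ((`) sing) ` matchings D"
  unfolding TD_def by (rule matchings_image[OF inj_sing])

lemma max_TD: "Max (card ` matchings TD) = mD"
  unfolding matchings_TD mD_def by (simp add: image_image card_image_image[OF inj_sing])

lemma finite_TE: "finite TE"
proof -
  have "attach \<subseteq> V" using E_sub unfolding attach_def L_def by blast
  then have "finite attach" using finV finite_subset by blast
  then show ?thesis unfolding TE_def TD_def using finD by simp
qed

text \<open>The cyclic vertex has at least three elements, so it is not one of the
  singletons.\<close>

lemma W_notin_TD: "e \<in> TD \<Longrightarrow> W \<notin> e"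
proof
  assume "e \<in> TD" "W \<in> e"
  then obtain v where "W = {v}" unfolding TD_def by blast
  then show False using distinct_card[OF xs_distinct] q_ge by simp
qed

text \<open>A matching of the contraction has at most one edge \<open>{W, {u}}\<close> at the cyclic
  vertex, and the rest comes from a matching of \<open>D\<close> that misses \<open>u\<close>.
  Exceeding \<open>mD\<close> therefore requires a maximum matching of \<open>D\<close> that misses
  an attaching vertex.\<close>

lemma max_TE: "Max (card ` matchings TE) = mD \<longleftrightarrow> saturated"
proof -
  have fin: "finite (card ` matchings TE)" using finite_matchings[OF finite_TE] by simp
  have ge: "mD \<le> Max (card ` matchings TE)"
    unfolding max_TD[symmetric]
  proof (rule Max_mono[OF _ _ fin])
    show "card ` matchings TD \<subseteq> card ` matchings TE"
      using matchings_mono[of TD TE] unfolding TE_def by blast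
    show "card ` matchings TD \<noteq> {}" using matchings_empty[of TD] by blast
  qed
  have "Max (card ` matchings TE) \<le> mD" if sat: saturated
  proof -
    have "card M \<le> mD" if M: "M \<in> matchings TE" for M
    proof (cases "M \<subseteq> TD")
      case True
      then have "M \<in> matchings TD" using matchings_subset[OF M, of M TD] by simp
      then obtain N where "N \<in> matchings D" "M = (`) sing ` N" unfolding matchings_TD by blast
      then show ?thesis using mD_ge card_image_image[OF inj_sing] by metis
    next
      case False
      then obtain u where u: "u \<in> attach" "{W, {u}} \<in> M"
        using matchings_sub[OF M] unfolding TE_def by blast
      let ?e = "{W, {u}}"
      have "M - {?e} \<subseteq> TD"
      proof
        fix d assume d: "d \<in> M - {?e}"
        then have "d \<inter> ?e = {}" using matchings_disjoint[OF M _ u(2)] by blast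
        then have "W \<notin> d" by blast
        then show "d \<in> TD" using d matchings_sub[OF M] unfolding TE_def by blast
      qed
      then have "M - {?e} \<in> matchings TD" using matchings_subset[OF M, of "M - {?e}" TD] by blast
      then obtain N where N: "N \<in> matchings D" "M - {?e} = (`) sing ` N" unfolding matchings_TD by blast
      have "u \<notin> \<Union>N"
      proof
        assume "u \<in> \<Union>N"
        then obtain d where d: "d \<in> N" "u \<in> d" by blast
        then have "sing ` d \<in> M - {?e}" "{u} \<in> sing ` d" using N(2) by auto
        then show False using matchings_disjoint[OF M _ u(2), of "sing ` d"] by blast
      qed
      then have "card N \<noteq> mD" using sat u(1) N(1) unfolding saturated_def by blast
      then have "card N < mD" using mD_ge[OF N(1)] by simp
      moreover have "card (M - {?e}) = card N" unfolding N(2) by (rule card_image_image[OF inj_sing])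
      ultimately show ?thesis using card_Diff_singleton[OF u(2)] by linarith
    qed
    moreover have "card ` matchings TE \<noteq> {}" using matchings_empty[of TE] by blast
    ultimately show ?thesis using fin by (intro Max.boundedI) auto
  qed
  moreover have "mD < Max (card ` matchings TE)" if unsat: "\<not> saturated"
  proof -
    obtain N u where N: "N \<in> matchings D" "card N = mD" "u \<in> attach" "u \<notin> \<Union>N"
      using unsat unfolding saturated_def by blast
    let ?M = "(`) sing ` N" and ?e = "{W, {u}}"
    have "?M \<in> matchings TD" unfolding matchings_TD using N(1) by blast
    then have M: "?M \<in> matchings TE" "?M \<subseteq> TD"
      using matchings_mono[of TD TE] matchings_sub unfolding TE_def by blast+
    then have dis: "?e \<inter> \<Union>?M = {}" using N(4) W_notin_TD by blast
    then have nin: "?e \<notin> ?M" by blast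
    have "insert ?e ?M \<in> matchings TE"
      using matchings_insert_iff[OF nin, of TE] M(1) dis N(3) unfolding TE_def by blast
    moreover have "card (insert ?e ?M) = Suc mD"
    proof -
      have "finite ?M" using M(2) finite_TE unfolding TE_def by (meson finite_Un finite_subset)
      then show ?thesis using nin N(2) by (simp add: card_image_image[OF inj_sing])
    qed
    ultimately have "Suc mD \<in> card ` matchings TE" by force
    then show ?thesis using Max_ge[OF fin] by fastforce
  qed
  ultimately show ?thesis using ge by force
qed

section \<open>The characteristic polynomial of an unbalanced signed graph\<close>

text \<open>The Leibniz sum runs over permutations of indices; conjugation with the enumeration
  \<open>vs\<close> carries it to permutations of vertices, where \<open>permutation_sum\<close>
  applies.\<close>

lemma char_poly_eq_matching_expansion:
  fixes \<sigma> :: "'a set \<Rightarrow> real"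
  assumes vs: "distinct vs" "set vs = V"
    and \<sigma>: "\<And>e. e \<in> E \<Longrightarrow> \<sigma> e * \<sigma> e = 1" and neg: "(\<Prod>e\<in>C. \<sigma> e) = - 1"
  defines "A \<equiv> mat (length vs) (length vs) (\<lambda>(i, j). if {vs ! i, vs ! j} \<in> E then \<sigma> {vs ! i, vs ! j} else 0)"
  shows "char_poly A = matching_expansion"
proof -
  let ?n = "length vs"
  \<comment> \<open>The off-diagonal entries of xI - A as constant polynomials; they still square to
    1.\<close>
  define t where "t e = [:- \<sigma> e:]" for e
  define b where "b u v = (if u = v then [:0, 1:] else if {u, v} \<in> E then t {u, v} else 0)" for u v
  define I where "I = {0..<?n}"
  define f where "f i = vs ! i" for i
  have bij: "bij_betw f I V"
    unfolding f_def I_def using bij_betw_nth[OF vs(1) refl vs(2)[symmetric]] by (simp add: atLeast0LessThan)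
  then have inj: "inj_on f I" by (simp add: bij_betw_def)
  define g where "g = inv_into I f"
  have bij': "bij_betw g V I" unfolding g_def by (rule bij_betw_inv_into[OF bij])
  have gf: "g (f i) = i" if "i \<in> I" for i unfolding g_def by (rule inv_into_f_f[OF inj that])
  have fg: "f (g v) = v" if "v \<in> V" for v
    unfolding g_def using bij that by (simp add: bij_betw_def f_inv_into_f)
  have carrier: "A \<in> carrier_mat ?n ?n" by (simp add: A_def)
  have entry: "char_poly_matrix A $$ (i, j) = b (f i) (f j)" if "i \<in> I" "j \<in> I" for i j
  proof -
    have "f i = f j \<longleftrightarrow> i = j" using inj that by (auto dest: inj_onD)
    moreover have "{v} \<notin> E" for v using E_doubleton[of v v] by auto
    ultimately show ?thesis
      using that by (auto simp: char_poly_matrix_def A_def b_def t_def f_def I_def)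
  qed
  have "char_poly A = (\<Sum>p | p permutes I. signof p * (\<Prod>i\<in>I. char_poly_matrix A $$ (i, p i)))"
    unfolding char_poly_def I_def by (rule det_def'[OF char_poly_matrix_closed[OF carrier]])
  also have "\<dots> = (\<Sum>p | p permutes I. of_int (sign p) * (\<Prod>i\<in>I. b (f i) (f (p i))))"
  proof (intro sum.cong refl)
    fix p assume "p \<in> {p. p permutes I}"
    then have "p i \<in> I" if "i \<in> I" for i using permutes_in_image[of p I i] that by simp
    then show "signof p * (\<Prod>i\<in>I. char_poly_matrix A $$ (i, p i)) =
        of_int (sign p) * (\<Prod>i\<in>I. b (f i) (f (p i)))"
      using entry by (simp cong: prod.cong)
  qed
  also have "\<dots> = (\<Sum>p | p permutes V. of_int (sign p) * (\<Prod>v\<in>V. b v (p v)))"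
  proof (rule sum.reindex_bij_witness[of _ "map_permutation V g" "map_permutation I f"])
    fix p assume "p \<in> {p. p permutes I}"
    then have p: "p permutes I" by simp
    show "map_permutation V g (map_permutation I f p) = p"
      by (rule map_permutation_compose_inv[OF bij p gf])
    show "map_permutation I f p \<in> {p. p permutes V}"
      using map_permutation_permutes[OF bij p] by simp
    have "(\<Prod>v\<in>V. b v (map_permutation I f p v)) = (\<Prod>i\<in>I. b (f i) (map_permutation I f p (f i)))"
      by (rule prod.reindex_bij_betw[OF bij, symmetric])
    also have "\<dots> = (\<Prod>i\<in>I. b (f i) (f (p i)))"
      using map_permutation_apply[OF inj] by (simp cong: prod.cong)
    finally show "of_int (sign (map_permutation I f p)) * (\<Prod>v\<in>V. b v (map_permutation I f p v)) =
        of_int (sign p) * (\<Prod>i\<in>I. b (f i) (f (p i)))"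
      using sign_map_permutation[OF inj p] by (simp add: I_def)
  next
    fix p assume "p \<in> {p. p permutes V}"
    then have p: "p permutes V" by simp
    show "map_permutation I f (map_permutation V g p) = p"
      by (rule map_permutation_compose_inv[OF bij' p fg])
    show "map_permutation V g p \<in> {p. p permutes I}"
      using map_permutation_permutes[OF bij' p] by simp
  qed
  also have "\<dots> = (\<Sum>M\<in>matchings E. (- 1) ^ card M * [:0, 1:] ^ (n - 2 * card M)) +
    2 * ((- 1) ^ (q - 1) * (\<Prod>e\<in>C. t e)) *
      (\<Sum>N\<in>matchings D. (- 1) ^ card N * [:0, 1:] ^ (n - q - 2 * card N))"
  proof -
    have tt: "t e * t e = 1" if "e \<in> E" for e using \<sigma>[OF that] by (simp add: t_def one_pCons)
    show ?thesis unfolding b_def by (rule permutation_sum[OF tt])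
  qed
  \<comment> \<open>The entries give (-1)^q times the cycle sign -1, and the sign of a q-cycle turns
    this into 1 for either parity.\<close>
  also have "(- 1) ^ (q - 1) * (\<Prod>e\<in>C. t e) = 1"
  proof -
    have "(\<Prod>e\<in>F. t e) = [:(- 1) ^ card F * (\<Prod>e\<in>F. \<sigma> e):]" if "finite F" for F
      using that by (induction F rule: finite_induct) (simp_all add: t_def one_pCons)
    moreover have "finite C" using C_sub finE finite_subset by blast
    ultimately have "(\<Prod>e\<in>C. t e) = [:(- 1) ^ q * - 1:]" using neg card_C by metis
    moreover obtain r where "q = Suc r" using q_ge by (cases q) auto
    ultimately show ?thesis by (cases "even r") (auto simp: one_pCons)
  qed
  finally show ?thesis by (simp add: matching_expansion_def)
qed

end

theorem theorem1p1:
  fixes G :: "'a pair_pre_digraph" and \<sigma> :: "'a set \<Rightarrow> real"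
    and C :: "'a set set" and q :: nat and vs :: "'a list"
  assumes "pair_graph G"
    and "signing G \<sigma>"
    and "unicyclic G"
    and "\<not> balanced G \<sigma>"
    and "is_cycle G C" and "q = card C"
    and "distinct vs" and "set vs = pverts G"
  defines "\<eta> \<equiv> int (nullity G \<sigma> vs)"
    and "n \<equiv> int (card (pverts G))"
    and "m \<equiv> int (matching_number (with_proj G))"
    and "mT \<equiv> matching_number (with_proj (contract_cycles G))"
    and "mT' \<equiv> matching_number (delete_cyclic_vertices G)"
  shows "(q mod 2 = 1 \<and> mT' = mT \<longrightarrow> \<eta> = n - 2 * m - 1) \<and>
         (q mod 4 = 2 \<and> mT' = mT \<longrightarrow> \<eta> = n - 2 * m + 2) \<and>
         (\<not> (q mod 2 = 1 \<and> mT' = mT) \<and> \<not> (q mod 4 = 2 \<and> mT' = mT) \<longrightarrow> \<eta> = n - 2 * m)"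
proof -
  interpret pair_graph G by fact
  define E where "E = uedges (with_proj G)"
  \<comment> \<open>Symmetry of the arc set lets an unordered edge stand for both of its
    arcs.\<close>
  have arc: "(u, v) \<in> parcs G \<longleftrightarrow> {u, v} \<in> E" for u v
  proof
    assume "{u, v} \<in> E"
    then obtain a b where "(a, b) \<in> parcs G" "{a, b} = {u, v}" by (auto simp: E_def uedges_def)
    then show "(u, v) \<in> parcs G" using arcs_symmetric by (auto simp: doubleton_eq_iff)
  qed (force simp: E_def uedges_def)
  have adj: "{(u, v). {u, v} \<in> E} = parcs G" using arc by auto
  have uniq: "C' = C" if "is_cycle G C'" for C'
    using assms(3) that assms(5) unfolding unicyclic_def by blast
  obtain xs where xs: "closed_path (parcs G) xs" "C = closed_path_edges xs"
    using is_cycleE[OF assms(5)] .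
  interpret U: unicyclic_edges "pverts G" E xs
  proof
    show "finite (pverts G)" by (rule finite_verts)
    fix e assume "e \<in> E"
    then obtain a b where ab: "(a, b) \<in> parcs G" "e = {a, b}" by (auto simp: E_def uedges_def)
    then show "e \<subseteq> pverts G" using in_arcsD1 in_arcsD2 by auto
    have "a \<noteq> b" using ab(1) no_loops by force
    then show "card e = 2" using ab(2) by simp
  next
    show "closed_path {(u, v). {u, v} \<in> E} xs" unfolding adj by (rule xs(1))
    fix ys assume "closed_path {(u, v). {u, v} \<in> E} ys"
    then have "is_cycle G (closed_path_edges ys)" unfolding adj by (rule closed_path_imp_is_cycle)
    then show "closed_path_edges ys = closed_path_edges xs" using uniq xs(2) by blast
  qed
  have q: "q = length xs" using assms(6) U.card_C xs(2) by simp
  have W: "\<Union>C = set xs" using U.Union_C xs(2) by simp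
  have cv: "cyclic_vertices G = {set xs}"
    unfolding cyclic_vertices_def using uniq assms(5) W by blast
  have m: "m = int U.mE" unfolding m_def matching_number_eq E_def[symmetric] U.mE_def ..

  have \<sigma>: "\<sigma> e = 1 \<or> \<sigma> e = - 1" if "e \<in> E" for e
    using assms(2) that unfolding signing_def E_def by blast
  \<comment> \<open>Being unbalanced only says that some cycle has a sign other than 1. That cycle
    is \<open>C\<close>, and a product of signs is 1 or -1.\<close>
  have "cycle_sign \<sigma> C \<noteq> 1"
    using assms(4) uniq unfolding balanced_def by blast
  moreover have "(\<Prod>e\<in>F. \<sigma> e) = 1 \<or> (\<Prod>e\<in>F. \<sigma> e) = - 1" if "finite F" "F \<subseteq> E" for F
    using that by (induction F rule: finite_induct) (use \<sigma> in fastforce)+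
  moreover have "finite C" "C \<subseteq> E" using U.C_sub U.finE finite_subset unfolding xs(2) by blast+
  ultimately have neg: "(\<Prod>e\<in>C. \<sigma> e) = - 1" unfolding cycle_sign_def by blast
  have "adjacency_matrix G \<sigma> vs = mat (length vs) (length vs)
      (\<lambda>(i, j). if {vs ! i, vs ! j} \<in> E then \<sigma> {vs ! i, vs ! j} else 0)"
    unfolding adjacency_matrix_def arc ..
  then have "char_poly (adjacency_matrix G \<sigma> vs) = U.matching_expansion"
    using U.char_poly_eq_matching_expansion[OF assms(7,8), of \<sigma>] \<sigma> neg xs(2) by fastforce
  then have \<eta>: "\<eta> = int (Polynomial.order 0 U.matching_expansion)"
    unfolding \<eta>_def nullity_def by simp

  have D_iff: "{u, v} \<in> U.D \<longleftrightarrow> (u, v) \<in> parcs G \<and> u \<notin> set xs \<and> v \<notin> set xs" for u v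
    unfolding U.D_def arc by auto
  have verts: "A \<in> pverts (contract_cycles G) \<longleftrightarrow> A = set xs \<or> (\<exists>v. A = {v} \<and> v \<in> pverts G \<and> v \<notin> set xs)" for A
    unfolding contract_cycles_def Let_def cv by auto
  have arcs: "(A, B) \<in> parcs (contract_cycles G) \<longleftrightarrow> A \<in> pverts (contract_cycles G) \<and>
      B \<in> pverts (contract_cycles G) \<and> A \<noteq> B \<and> (\<exists>u\<in>A. \<exists>v\<in>B. (u, v) \<in> parcs G)" for A B
    unfolding contract_cycles_def Let_def by simp
  \<comment> \<open>Keeps the two kinds of vertices of the contraction apart.\<close>
  have nsing: "set xs \<noteq> {v}" for v
    using distinct_card[OF U.xs_distinct] U.q_ge by auto
  have sing_arc: "({u}, {v}) \<in> parcs (contract_cycles G) \<longleftrightarrow> {u, v} \<in> U.D" for u v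
  proof -
    have v: "{w} \<in> pverts (contract_cycles G) \<longleftrightarrow> w \<in> pverts G \<and> w \<notin> set xs" for w
      unfolding verts using nsing[of w] by auto
    have "u \<in> pverts G \<and> v \<in> pverts G \<and> u \<noteq> v" if "(u, v) \<in> parcs G"
      using that U.E_sub[of "{u, v}"] U.E_doubleton[of u v] arc[of u v] by auto
    then show ?thesis unfolding arcs v D_iff by auto
  qed
  have edge_T: "e \<in> uedges (with_proj (contract_cycles G)) \<longleftrightarrow>
      (\<exists>A B. e = {A, B} \<and> (A, B) \<in> parcs (contract_cycles G))" for e
    unfolding uedges_def image_iff by (simp add: Bex_def conj_commute)
  have edge_T': "e \<in> uedges (delete_cyclic_vertices G) \<longleftrightarrow>
      (\<exists>A B. e = {A, B} \<and> (A, B) \<in> parcs (contract_cycles G) \<and> A \<noteq> set xs \<and> B \<noteq> set xs)" for e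
  proof -
    have "(A, B) \<in> pre_digraph.arcs (delete_cyclic_vertices G) \<longleftrightarrow>
        (A, B) \<in> parcs (contract_cycles G) \<and> A \<noteq> set xs \<and> B \<noteq> set xs" for A B
      unfolding delete_cyclic_vertices_def cv induce_subgraph_arcs using arcs[of A B] by auto
    moreover have "tail (delete_cyclic_vertices G) = fst" "head (delete_cyclic_vertices G) = snd"
      by (simp_all add: delete_cyclic_vertices_def)
    ultimately show ?thesis
      unfolding uedges_def image_iff by (simp add: Bex_def conj_commute)
  qed
  have TD: "uedges (delete_cyclic_vertices G) = U.TD"
  proof (intro equalityI subsetI)
    fix e assume "e \<in> uedges (delete_cyclic_vertices G)"
    then obtain A B where AB: "e = {A, B}" "(A, B) \<in> parcs (contract_cycles G)" "A \<noteq> set xs" "B \<noteq> set xs"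
      unfolding edge_T' by (elim exE conjE)
    then have "A \<in> pverts (contract_cycles G)" "B \<in> pverts (contract_cycles G)" unfolding arcs by blast+
    then obtain u v where "A = {u}" "B = {v}" using AB(3,4) unfolding verts by blast
    then show "e \<in> U.TD" using AB sing_arc unfolding U.TD_def by (intro image_eqI[of _ _ "{u, v}"]) auto
  next
    fix e assume "e \<in> U.TD"
    then obtain d where d: "d \<in> U.D" "e = (\<lambda>v. {v}) ` d" unfolding U.TD_def by blast
    obtain u v where uv: "d = {u, v}" using U.E_card[of d] U.D_sub d(1) by (auto simp: card_2_iff)
    have "({u}, {v}) \<in> parcs (contract_cycles G)" using d uv sing_arc by simp
    moreover have "e = {{u}, {v}}" using d(2) uv by simp
    moreover have "{u} \<noteq> set xs" "{v} \<noteq> set xs" using nsing by metis+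
    ultimately show "e \<in> uedges (delete_cyclic_vertices G)"
      unfolding edge_T' by (intro exI conjI)
  qed
  have attach: "v \<in> U.attach \<longleftrightarrow> v \<notin> set xs \<and> (\<exists>u\<in>set xs. {u, v} \<in> E)" for v
  proof
    assume "v \<in> U.attach"
    then show "v \<notin> set xs \<and> (\<exists>u\<in>set xs. {u, v} \<in> E)" using U.attach_cases by metis
  next
    assume "v \<notin> set xs \<and> (\<exists>u\<in>set xs. {u, v} \<in> E)"
    then show "v \<in> U.attach" unfolding U.attach_def U.L_def by blast
  qed
  have TE: "uedges (with_proj (contract_cycles G)) = U.TE"
  proof (intro equalityI subsetI)
    fix e assume "e \<in> uedges (with_proj (contract_cycles G))"
    then obtain A B where AB: "e = {A, B}" "(A, B) \<in> parcs (contract_cycles G)"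
      unfolding edge_T by (elim exE conjE)
    then have v: "A \<in> pverts (contract_cycles G)" "B \<in> pverts (contract_cycles G)" "A \<noteq> B"
      "\<exists>u\<in>A. \<exists>v\<in>B. (u, v) \<in> parcs G" unfolding arcs by blast+
    \<comment> \<open>There is only one cyclic vertex and \<open>A \<noteq> B\<close>, so at most
      one end is cyclic.\<close>
    consider (1) v where "A = set xs" "B = {v}" "v \<notin> set xs"
      | (2) v where "B = set xs" "A = {v}" "v \<notin> set xs"
      | (3) u v where "A = {u}" "B = {v}"
      using v(1-3) unfolding verts by blast
    then show "e \<in> U.TE"
    proof cases
      case 1
      then have "v \<in> U.attach" using v(4) arc attach by blast
      then show ?thesis using 1 AB(1) unfolding U.TE_def by blast
    next
      case 2
      then have "v \<in> U.attach" using v(4) arc attach by (metis insert_commute singletonD)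
      then show ?thesis using 2 AB(1) unfolding U.TE_def by (auto simp: insert_commute)
    next
      case 3
      then have "{u, v} \<in> U.D" using AB sing_arc by simp
      then show ?thesis using 3 AB(1) unfolding U.TE_def U.TD_def by (intro UnI1 image_eqI[of _ _ "{u, v}"]) auto
    qed
  next
    fix e assume "e \<in> U.TE"
    then consider (1) "e \<in> U.TD" | (2) v where "v \<in> U.attach" "e = {set xs, {v}}"
      unfolding U.TE_def by blast
    then show "e \<in> uedges (with_proj (contract_cycles G))"
    proof cases
      case 1
      then show ?thesis
        unfolding TD[symmetric] edge_T edge_T' by (elim exE conjE) (intro exI conjI)
    next
      case 2
      obtain u where u: "u \<in> set xs" "{u, v} \<in> E" "v \<notin> set xs" using attach 2(1) by blast
      have "v \<in> pverts G" using U.E_sub[OF u(2)] by blast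
      then have "(set xs, {v}) \<in> parcs (contract_cycles G)"
        unfolding arcs verts using nsing u arc by blast
      then show ?thesis unfolding edge_T using 2(2) by (intro exI conjI)
    qed
  qed
  have sat: "mT' = mT \<longleftrightarrow> U.saturated"
    unfolding mT'_def mT_def matching_number_eq TD TE U.max_TD U.max_TE[symmetric] by (rule eq_commute)

  have n: "n = int (card (pverts G))" by (simp add: n_def)
  show ?thesis
  proof (cases "odd q")
    case True
    then have "q mod 4 \<noteq> 2" "q mod 2 = 1" by presburger+
    then show ?thesis
      using U.order_odd_saturated U.order_odd_unsaturated True unfolding sat \<eta> m n q by auto
  next
    case False
    then obtain h where h: "q = 2 * h" by blast
    \<comment> \<open>The residue of \<open>q\<close> modulo 4 is the parity of \<open>h\<close>,
      that is, the relative sign of the two sums.\<close>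
    have "q mod 2 \<noteq> 1" "q mod 4 = 2 \<longleftrightarrow> odd h" using h by presburger+
    then show ?thesis
      using h U.order_0_mod_4[of h] U.order_2_mod_4_saturated[of h] U.order_2_mod_4_unsaturated[of h]
      unfolding sat \<eta> m n q by auto
  qed
qed

end
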